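(* Let $n\ge1$, let $V$ be a complex vector space with $\dim V=2n+1$, and let $\rho$ be the representation of $\mathfrak{gl}(2n+1)=\mathfrak{gl}(V)$ or of $\mathfrak{sl}(2n+1)=\mathfrak{sl}(V)$ on the space of skew-symmetric forms $\Lambda^2(V)$ corresponding to the congruence action. Put $\delta=1$ in the case of $\mathfrak{gl}(2n+1)$ and $\delta=0$ in the case of $\mathfrak{sl}(2n+1)$. Then the Jordan--Kronecker invariants of $\rho$ are $n(2n+3)+\delta$ horizontal indices: $1$ taken $2n+\delta$ times and $2$ taken $n(2n+1)$ times (and there are no other blocks).
   Context: Everything is over $\mathbb{C}$ and finite-dimensional. Pencils. For linear maps $A,B:U\to V$ there are bases of $U$ and $V$ (Kronecker's theorem) in which all matrices $A+\lambda B$ are simultaneously block-diagonal, each pair of diagonal blocks $(A_i,B_i)$ being one of: (i) a $k\times k$ Jordan block with eigenvalue $\lambda_0\in\mathbb{C}$: $A_i=J_k(\lambda_0)$ (the upper triangular Jordan block), $B_i=I_k$; (ii) a $k\times k$ Jordan block with eigenvalue $\infty$: $A_i=I_k$, $B_i=J_k(0)$; (iii) a horizontal Kronecker block of size $(h-1)\times h$, $h\ge 1$: $A_i=(0\,|\,I_{h-1})$, $B_i=(I_{h-1}\,|\,0)$; (iv) a vertical Kronecker block of size $v\times(v-1)$, $v\ge1$: the transposes of the matrices in (iii) with $h=v$. A $0\times 1$ horizontal block ($h=1$) is a zero column and a $1\times 0$ vertical block ($v=1$) is a zero row. The blocks are unique up to permutation. The numbers $h$ (widths of horizontal blocks) are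 the horizontal indices, the numbers $v$ (heights of vertical blocks) are the vertical indices. Representations. For a representation $\rho:\mathfrak{g}\to\mathfrak{gl}(W)$ and $x\in W$ put $R_x:\mathfrak{g}\to W$, $R_x(\xi)=\rho(\xi)x$. The algebraic type of the pencil $R_a+\lambda R_b=R_{a+\lambda b}$ is the collection: number of distinct eigenvalues of Jordan blocks, number and sizes of the Jordan blocks for each eigenvalue, horizontal and vertical indices (with multiplicity). The Jordan--Kronecker (JK) invariants of $\rho$ are the algebraic type of $R_{a+\lambda b}$ for a generic pair $(a,b)\in W\times W$ (i.e. for all pairs in some non-empty Zariski open subset). Congruence action. In a fixed basis of $V$, the group $\mathrm{GL}(V)$ acts on bilinear forms (square matrices $Q$) by $(P,Q)\mapsto PQP^T$; the corresponding Lie algebra representation is $\rho(X)Q=XQ+QX^T$. Here it is restricted to skew-symmetric matrices $Q\in\Lambda^2(V)$ (and to traceless $X$ in the $\mathfrak{sl}$ case). *)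

theory Defs
  imports "HOL-Analysis.Analysis" "Jordan_Normal_Form.Jordan_Normal_Form"
begin

section \<open>Kronecker blocks and the algebraic type of a pencil\<close>

datatype eigenvalue = Finite complex | Infinity

text \<open>
  \<open>Jordan k e\<close> is a \<open>k \<times> k\<close> block, \<open>Horizontal h\<close> an \<open>(h - 1) \<times> h\<close> block and
  \<open>Vertical v\<close> a \<open>v \<times> (v - 1)\<close> block.
\<close>

datatype kronecker_block = Jordan nat eigenvalue | Horizontal nat | Vertical nat

fun block_size :: "kronecker_block \<Rightarrow> nat" where
  "block_size (Jordan k e) = k"
| "block_size (Horizontal h) = h"
| "block_size (Vertical v) = v"

text \<open>The matrices \<open>(0 | I)\<close> and \<open>(I | 0)\<close> of size \<open>(h - 1) \<times> h\<close>.\<close>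

definition horizontal_A :: "nat \<Rightarrow> complex Matrix.mat" where
  "horizontal_A h = Matrix.mat (h - 1) h (\<lambda>(i, j). if j = Suc i then 1 else 0)"

definition horizontal_B :: "nat \<Rightarrow> complex Matrix.mat" where
  "horizontal_B h = Matrix.mat (h - 1) h (\<lambda>(i, j). if j = i then 1 else 0)"

fun block_A :: "kronecker_block \<Rightarrow> complex Matrix.mat" where
  "block_A (Jordan k (Finite z)) = jordan_block k z"
| "block_A (Jordan k Infinity) = 1\<^sub>m k"
| "block_A (Horizontal h) = horizontal_A h"
| "block_A (Vertical v) = transpose_mat (horizontal_A v)"

fun block_B :: "kronecker_block \<Rightarrow> complex Matrix.mat" where
  "block_B (Jordan k (Finite z)) = 1\<^sub>m k"
| "block_B (Jordan k Infinity) = jordan_block k 0"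
| "block_B (Horizontal h) = horizontal_B h"
| "block_B (Vertical v) = transpose_mat (horizontal_B v)"

text \<open>
  \<open>jordan_part\<close> contains one multiset of block sizes for each distinct eigenvalue (infinity
  included), so its size is the number of distinct eigenvalues; the eigenvalues themselves are
  not recorded.
\<close>

record algebraic_type =
  jordan_part :: "nat multiset multiset"
  horizontal_indices :: "nat multiset"
  vertical_indices :: "nat multiset"

definition block_eigenvalues :: "kronecker_block list \<Rightarrow> eigenvalue set" where
  "block_eigenvalues bs = {e. \<exists>k. Jordan k e \<in> set bs}"

definition jordan_sizes :: "kronecker_block list \<Rightarrow> eigenvalue \<Rightarrow> nat multiset" where
  "jordan_sizes bs e = mset [k. Jordan k e' \<leftarrow> bs, e' = e]"

definition type_of_blocks :: "kronecker_block list \<Rightarrow> algebraic_type" where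
  "type_of_blocks bs =
     \<lparr> jordan_part = image_mset (jordan_sizes bs) (mset_set (block_eigenvalues bs)),
       horizontal_indices = mset [h. Horizontal h \<leftarrow> bs],
       vertical_indices = mset [v. Vertical v \<leftarrow> bs] \<rparr>"

text \<open>
  Complex vector spaces are linear subspaces of a type equipped with a scalar multiplication,
  in the style of \<^theory>\<open>HOL.Vector_Spaces\<close>.
\<close>

definition is_basis_list :: "(complex \<Rightarrow> 'a \<Rightarrow> 'a) \<Rightarrow> 'a set \<Rightarrow> 'a :: ab_group_add list \<Rightarrow> bool" where
  "is_basis_list s U us \<longleftrightarrow>
     distinct us \<and> \<not> module.dependent s (set us) \<and> module.span s (set us) = U"

text \<open>The \<open>j\<close>-th column of the matrix contains the coordinates of the image of \<open>us ! j\<close>.\<close>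

definition represents ::
  "(complex \<Rightarrow> 'b \<Rightarrow> 'b) \<Rightarrow> 'a list \<Rightarrow> 'b :: ab_group_add list \<Rightarrow> complex Matrix.mat \<Rightarrow> ('a \<Rightarrow> 'b) \<Rightarrow> bool"
where
  "represents s us vs M f \<longleftrightarrow>
     M \<in> carrier_mat (length vs) (length us) \<and>
     (\<forall>j < length us. f (us ! j) = (\<Sum>i < length vs. s (M $$ (i, j)) (vs ! i)))"

definition has_kronecker_form ::
  "(complex \<Rightarrow> 'a \<Rightarrow> 'a) \<Rightarrow> 'a :: ab_group_add set \<Rightarrow> (complex \<Rightarrow> 'b \<Rightarrow> 'b) \<Rightarrow> 'b :: ab_group_add set \<Rightarrow>
   ('a \<Rightarrow> 'b) \<Rightarrow> ('a \<Rightarrow> 'b) \<Rightarrow> kronecker_block list \<Rightarrow> bool"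
where
  "has_kronecker_form s1 U s2 V A B bs \<longleftrightarrow>
     (\<forall>b \<in> set bs. block_size b \<ge> 1) \<and>
     (\<exists>us vs. is_basis_list s1 U us \<and> is_basis_list s2 V vs \<and>
        represents s2 us vs (diag_block_mat (map block_A bs)) A \<and>
        represents s2 us vs (diag_block_mat (map block_B bs)) B)"

text \<open>
  The algebraic type of the pencil \<open>A + \<lambda>B\<close> of linear maps \<open>U \<rightarrow> V\<close>, as a relation; by Kronecker's
  theorem there is exactly one such \<open>T\<close> when \<open>U\<close> and \<open>V\<close> are finite-dimensional.
\<close>

definition has_algebraic_type ::
  "(complex \<Rightarrow> 'a \<Rightarrow> 'a) \<Rightarrow> 'a :: ab_group_add set \<Rightarrow> (complex \<Rightarrow> 'b \<Rightarrow> 'b) \<Rightarrow> 'b :: ab_group_add set \<Rightarrow>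
   ('a \<Rightarrow> 'b) \<Rightarrow> ('a \<Rightarrow> 'b) \<Rightarrow> algebraic_type \<Rightarrow> bool"
where
  "has_algebraic_type s1 U s2 V A B T \<longleftrightarrow>
     (\<exists>bs. has_kronecker_form s1 U s2 V A B bs \<and> T = type_of_blocks bs)"


section \<open>Zariski open subsets of a vector space\<close>

inductive polynomial_map :: "(complex \<Rightarrow> 'a \<Rightarrow> 'a) \<Rightarrow> ('a :: ab_group_add \<Rightarrow> complex) \<Rightarrow> bool"
  for s :: "complex \<Rightarrow> 'a \<Rightarrow> 'a"
where
  const: "polynomial_map s (\<lambda>_. c)"
| linear: "Vector_Spaces.linear s (*) f \<Longrightarrow> polynomial_map s f"
| add: "polynomial_map s f \<Longrightarrow> polynomial_map s g \<Longrightarrow> polynomial_map s (\<lambda>x. f x + g x)"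
| mult: "polynomial_map s f \<Longrightarrow> polynomial_map s g \<Longrightarrow> polynomial_map s (\<lambda>x. f x * g x)"

text \<open>
  Polynomial functions on a subspace \<open>W\<close> are the restrictions of polynomial functions on the
  ambient space, as linear functionals on \<open>W\<close> extend.
\<close>

definition zariski_open_in :: "(complex \<Rightarrow> 'a \<Rightarrow> 'a) \<Rightarrow> 'a :: ab_group_add set \<Rightarrow> 'a set \<Rightarrow> bool" where
  "zariski_open_in s W Z \<longleftrightarrow>
     (\<exists>F. (\<forall>f \<in> F. polynomial_map s f) \<and> Z = {x \<in> W. \<exists>f \<in> F. f x \<noteq> 0})"


section \<open>Jordan--Kronecker invariants of a representation\<close>

text \<open>
  For a representation \<open>\<rho>\<close> of \<open>\<gg>\<close> on \<open>W\<close>, the map \<open>R\<^sub>x\<close> is \<open>\<lambda>\<xi>. \<rho> \<xi> x\<close>.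
\<close>

definition has_jk_invariants ::
  "(complex \<Rightarrow> 'a \<Rightarrow> 'a) \<Rightarrow> 'a :: ab_group_add set \<Rightarrow> (complex \<Rightarrow> 'b \<Rightarrow> 'b) \<Rightarrow> 'b :: ab_group_add set \<Rightarrow>
   ('a \<Rightarrow> 'b \<Rightarrow> 'b) \<Rightarrow> algebraic_type \<Rightarrow> bool"
where
  "has_jk_invariants s1 \<gg> s2 W \<rho> T \<longleftrightarrow>
     (\<exists>Z. zariski_open_in (module_prod.scale s2 s2) (W \<times> W) Z \<and> Z \<noteq> {} \<and>
        (\<forall>(a, b) \<in> Z. has_algebraic_type s1 \<gg> s2 W (\<lambda>\<xi>. \<rho> \<xi> a) (\<lambda>\<xi>. \<rho> \<xi> b) T))"


section \<open>The congruence action on skew-symmetric forms\<close>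

definition cmat_scale :: "complex \<Rightarrow> complex^'m^'k \<Rightarrow> complex^'m^'k" where
  "cmat_scale c A = (\<chi> i j. c * A $ i $ j)"

lemma vector_space_cmat_scale: "vector_space cmat_scale"
  by unfold_locales (simp_all add: cmat_scale_def Finite_Cartesian_Product.vec_eq_iff algebra_simps)

definition gl :: "(complex^'m^'m) set" where
  "gl = UNIV"

definition sl :: "(complex^'m^'m) set" where
  "sl = {X. trace X = 0}"

definition skew_forms :: "(complex^'m^'m) set" where
  "skew_forms = {Q. transpose Q = - Q}"

definition congruence_rep :: "complex^'m^'m \<Rightarrow> complex^'m^'m \<Rightarrow> complex^'m^'m" where
  "congruence_rep X Q = X ** Q + Q ** transpose X"

text \<open>This is a representation of the Lie algebra of matrices on the skew-symmetric forms.\<close>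

lemma congruence_rep_skew_forms:
  assumes "Q \<in> skew_forms"
  shows "congruence_rep X Q \<in> skew_forms"
proof -
  have Q: "Q $ j $ i = - Q $ i $ j" for i j
  proof -
    have "Q $ j $ i = transpose Q $ i $ j"
      by (simp add: transpose_def)
    also have "\<dots> = - Q $ i $ j"
      using assms by (simp add: skew_forms_def)
    finally show ?thesis .
  qed
  have "(\<Sum>k\<in>UNIV. X $ j $ k * Q $ k $ i) = - (\<Sum>k\<in>UNIV. Q $ i $ k * X $ j $ k)" for i j
    unfolding sum_negf [symmetric] by (rule sum.cong [OF refl], subst Q, simp)
  then show ?thesis
    by (simp add: skew_forms_def congruence_rep_def transpose_def matrix_matrix_mult_def
        Finite_Cartesian_Product.vec_eq_iff)
qed

lemma congruence_rep_bracket: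
  "congruence_rep (X ** Y - Y ** X) Q =
     congruence_rep X (congruence_rep Y Q) - congruence_rep Y (congruence_rep X Q)"
proof -
  have distrib: "A ** (B + C) = A ** B + A ** C" "(A + B) ** C = A ** C + B ** C"
    "A ** (B - C) = A ** B - A ** C" "(A - B) ** C = A ** C - B ** C"
    for A B C :: "complex^'m^'m"
    by (simp_all add: matrix_matrix_mult_def Finite_Cartesian_Product.vec_eq_iff
        distrib_left distrib_right left_diff_distrib right_diff_distrib sum.distrib sum_subtractf)
  have "transpose (X ** Y - Y ** X) = transpose (X ** Y) - transpose (Y ** X)"
    by (simp add: transpose_def Finite_Cartesian_Product.vec_eq_iff)
  then show ?thesis
    by (simp add: congruence_rep_def distrib matrix_transpose_mul matrix_mul_assoc)
qed

end

theory Submission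
  imports Defs
begin

text \<open>
  A pencil \<open>A + \<lambda>B\<close> of maps \<open>U \<rightarrow> W\<close> has only horizontal blocks of widths 1 and 2 if and only if
  \<open>x \<mapsto> (A x, B x)\<close> maps \<open>U\<close> onto \<open>W \<times> W\<close>: a basis of the common kernel gives the blocks of width 1, and
  preimages of \<open>(0, w)\<close> and \<open>(w, 0)\<close> for \<open>w\<close> in a basis of \<open>W\<close> give the blocks of width 2.  The
  multiplicities are then determined by dimensions.

  For the congruence action, surjectivity of \<open>X \<mapsto> (X a + a X\<^sup>T, X b + b X\<^sup>T)\<close> on \<open>sl\<close> is an open
  condition on \<open>(a, b)\<close>, so one pair is enough.  Let \<open>a\<close> and \<open>b\<close> be the forms given by the even and the odd
  edges of a path on the \<open>2 n + 1\<close> basis vectors.  By duality for the trace form, surjectivity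
  means that \<open>a p + b q = c I\<close> with skew-symmetric \<open>p, q\<close> forces \<open>p = q = 0\<close>.  Entrywise, this equation
  propagates zeros along the diagonals and antidiagonals of \<open>p\<close> and \<open>q\<close>.
\<close>

no_notation Matrix.vec_index (infixl "$" 100)

subsection \<open>Pencils with surjective combined map\<close>

text \<open>The zero off-diagonal blocks contribute only terms \<open>s 0 x\<close>, so each half of
  the basis sees only its own diagonal block.\<close>

lemma represents_append:
  fixes vs vs' :: "'b :: ab_group_add list"
  assumes M: "represents s us vs M f" and N: "represents s us' vs' N f"
    and s0: "\<And>x. s 0 x = 0"
  shows "represents s (us @ us') (vs @ vs')
           (four_block_mat M (0\<^sub>m (dim_row M) (dim_col N)) (0\<^sub>m (dim_row N) (dim_col M)) N) f"
    (is "represents s _ _ ?D f")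
proof -
  have dims: "dim_row M = length vs" "dim_col M = length us" "dim_row N = length vs'" "dim_col N = length us'"
    using M N unfolding represents_def by auto
  have sum_add: "sum g {..<a + b} = sum g {..<a} + (\<Sum>i<b. g (a + i))" for g :: "nat \<Rightarrow> 'b" and a b
    by (induction b) (simp_all add: ac_simps)
  have "f ((us @ us') ! j) = (\<Sum>i < length (vs @ vs'). s (?D $$ (i, j)) ((vs @ vs') ! i))"
    if j: "j < length (us @ us')" for j
  proof (cases "j < length us")
    case True
    then have "f (us ! j) = (\<Sum>i < length vs. s (M $$ (i, j)) (vs ! i))"
      using M unfolding represents_def by auto
    then show ?thesis
      using True by (simp add: sum_add dims s0 nth_append)
  next
    case False
    then have "f (us' ! (j - length us)) = (\<Sum>i < length vs'. s (N $$ (i, j - length us)) (vs' ! i))"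
      using N j unfolding represents_def by auto
    then show ?thesis
      using False j by (simp add: sum_add dims s0 nth_append)
  qed
  then show ?thesis
    using dims unfolding represents_def by auto
qed

lemma represents_diag_block_mat_Cons:
  assumes "represents s us vs M f" and "represents s us' vs' (diag_block_mat Ms) f"
    and "\<And>x. s 0 x = 0"
  shows "represents s (us @ us') (vs @ vs') (diag_block_mat (M # Ms)) f"
  using represents_append[OF assms] by (simp add: Let_def)

text \<open>A block of width 1 has no rows: it takes a basis vector of the source and none of the
  target, so all it asks is that \<open>u\<close> lie in the kernel.\<close>

lemma represents_Horizontal_1:
  assumes "f u = 0"
  shows "represents s [u] [] (block_A (Horizontal 1)) f" "represents s [u] [] (block_B (Horizontal 1)) f"
  using assms by (auto simp: represents_def horizontal_A_def horizontal_B_def)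

text \<open>At width 2 the matrices are \<open>(0 1)\<close> and \<open>(1 0)\<close>. Hence the
  first pencil map kills the first vector of the pair and sends the second to \<open>w\<close>, and
  the second pencil map does the opposite.\<close>

lemma represents_Horizontal_2:
  assumes "s 0 w = 0" "s 1 w = w"
  shows "f u = 0 \<Longrightarrow> f u' = w \<Longrightarrow> represents s [u, u'] [w] (block_A (Horizontal 2)) f"
    and "f u = w \<Longrightarrow> f u' = 0 \<Longrightarrow> represents s [u, u'] [w] (block_B (Horizontal 2)) f"
  using assms by (auto simp: represents_def horizontal_A_def horizontal_B_def less_Suc_eq numeral_2_eq_2)

text \<open>\<open>us\<close> lists \<open>g w\<close> and \<open>h w\<close> next to each other
  because a block of width 2 occupies two consecutive columns and one row. The inductions peel off
  one block at a time.\<close>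

lemma represents_horizontal_blocks:
  assumes s0: "\<And>x. s 0 x = 0" and s1: "\<And>x. s 1 x = x"
    and "\<And>x. x \<in> set ks \<Longrightarrow> A x = 0" "\<And>x. x \<in> set ks \<Longrightarrow> B x = 0"
    and "\<And>w. w \<in> set ws \<Longrightarrow> A (g w) = 0" "\<And>w. w \<in> set ws \<Longrightarrow> B (g w) = w"
    and "\<And>w. w \<in> set ws \<Longrightarrow> A (h w) = w" "\<And>w. w \<in> set ws \<Longrightarrow> B (h w) = 0"
  defines "us \<equiv> ks @ concat (map (\<lambda>w. [g w, h w]) ws)"
    and "bs \<equiv> replicate (length ks) (Horizontal 1) @ replicate (length ws) (Horizontal 2)"
  shows "represents s us ws (diag_block_mat (map block_A bs)) A"
    and "represents s us ws (diag_block_mat (map block_B bs)) B"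
proof -
  note 0 = s0 s1
  let ?us = "concat (map (\<lambda>w. [g w, h w]) ws)" and ?bs = "replicate (length ws) (Horizontal 2)"
  have ws: "represents s ?us ws (diag_block_mat (map block_A ?bs)) A \<and>
        represents s ?us ws (diag_block_mat (map block_B ?bs)) B"
    using assms(5-8)
  proof (induction ws)
    case Nil
    then show ?case by (simp add: represents_def)
  next
    case (Cons w ws)
    then show ?case
      using represents_diag_block_mat_Cons[OF represents_Horizontal_2(1)[of s w A "g w" "h w", OF 0] _ 0(1)]
        represents_diag_block_mat_Cons[OF represents_Horizontal_2(2)[of s w B "g w" "h w", OF 0] _ 0(1)]
      by (simp del: diag_block_mat.simps block_A.simps block_B.simps)
  qed
  have "represents s us ws (diag_block_mat (map block_A bs)) A \<and>
        represents s us ws (diag_block_mat (map block_B bs)) B"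
    unfolding us_def bs_def using assms(3,4)
  proof (induction ks)
    case Nil
    then show ?case using ws by simp
  next
    case (Cons k ks)
    then show ?case
      using represents_diag_block_mat_Cons[OF represents_Horizontal_1(1)[of A k s] _ 0(1)]
        represents_diag_block_mat_Cons[OF represents_Horizontal_1(2)[of B k s] _ 0(1)]
      by (simp del: diag_block_mat.simps block_A.simps block_B.simps)
  qed
  then show "represents s us ws (diag_block_mat (map block_A bs)) A"
    and "represents s us ws (diag_block_mat (map block_B bs)) B" by auto
qed

section \<open>Bases built from the common kernel and from preimages\<close>

context vector_space_pair
begin

text \<open>Applying \<open>A\<close> to a linear relation leaves only the \<open>h\<close> terms,
  as a relation in \<open>W\<close>, and applying \<open>B\<close> leaves only the \<open>g\<close>
  terms. So these coefficients vanish, and what remains is a relation in \<open>K\<close>. The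
  disjointness claims serve to split sums and to count vectors.\<close>

lemma independent_kernel_preimages:
  assumes linA: "Vector_Spaces.linear s1 s2 A" and linB: "Vector_Spaces.linear s1 s2 B"
    and K: "vs1.independent K" "finite K" "\<And>x. x \<in> K \<Longrightarrow> A x = 0" "\<And>x. x \<in> K \<Longrightarrow> B x = 0"
    and W: "vs2.independent W" "finite W"
    and g: "\<And>w. w \<in> W \<Longrightarrow> A (g w) = 0" "\<And>w. w \<in> W \<Longrightarrow> B (g w) = w"
    and h: "\<And>w. w \<in> W \<Longrightarrow> A (h w) = w" "\<And>w. w \<in> W \<Longrightarrow> B (h w) = 0"
  shows "vs1.independent (K \<union> g ` W \<union> h ` W)"
    and "inj_on g W" "inj_on h W" "K \<inter> g ` W = {}" "(K \<union> g ` W) \<inter> h ` W = {}"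
proof -
  interpret A: Vector_Spaces.linear s1 s2 A by fact
  interpret B: Vector_Spaces.linear s1 s2 B by fact
  have W0: "0 \<notin> W" using W(1) vs2.dependent_zero by blast
  show inj: "inj_on g W" "inj_on h W"
    using g(2) h(1) by (metis inj_onI)+
  show disj: "K \<inter> g ` W = {}" "(K \<union> g ` W) \<inter> h ` W = {}"
  proof -
    \<comment> \<open>\<open>B\<close> vanishes on \<open>K\<close> but on no value of
      \<open>g\<close>; \<open>A\<close> vanishes on both but on no value of
      \<open>h\<close>.\<close>
    have "B x \<noteq> 0" if "x \<in> g ` W" for x using that g(2) W0 by auto
    then show "K \<inter> g ` W = {}" using K(4) by blast
    have "A x = 0" if "x \<in> K \<union> g ` W" for x using that K(3) g(1) by auto
    moreover have "A x \<noteq> 0" if "x \<in> h ` W" for x using that h(1) W0 by auto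
    ultimately show "(K \<union> g ` W) \<inter> h ` W = {}" by blast
  qed
  show "vs1.independent (K \<union> g ` W \<union> h ` W)"
  proof (rule vs1.independent_if_scalars_zero)
    show "finite (K \<union> g ` W \<union> h ` W)" using K W by simp
    fix u x
    assume sum0: "(\<Sum>x\<in>K \<union> g ` W \<union> h ` W. s1 (u x) x) = 0" and x: "x \<in> K \<union> g ` W \<union> h ` W"
    have split: "(\<Sum>x\<in>K. s1 (u x) x) + (\<Sum>w\<in>W. s1 (u (g w)) (g w)) + (\<Sum>w\<in>W. s1 (u (h w)) (h w)) = 0"
      using sum0 K(2) W(2) disj inj by (simp add: sum.union_disjoint sum.reindex)
    have "A ((\<Sum>x\<in>K. s1 (u x) x) + (\<Sum>w\<in>W. s1 (u (g w)) (g w)) + (\<Sum>w\<in>W. s1 (u (h w)) (h w)))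
        = (\<Sum>w\<in>W. s2 (u (h w)) w)"
      using K(3) g(1) h(1) by (simp add: A.add A.sum A.scale)
    then have "(\<Sum>w\<in>W. s2 (u (h w)) w) = 0" using split by simp
    then have uh: "u (h w) = 0" if "w \<in> W" for w
      using vs2.independentD[OF W(1,2) order.refl, of "\<lambda>w. u (h w)"] that by blast
    have "B ((\<Sum>x\<in>K. s1 (u x) x) + (\<Sum>w\<in>W. s1 (u (g w)) (g w)) + (\<Sum>w\<in>W. s1 (u (h w)) (h w)))
        = (\<Sum>w\<in>W. s2 (u (g w)) w)"
      using K(4) g(2) h(2) by (simp add: B.add B.sum B.scale)
    then have "(\<Sum>w\<in>W. s2 (u (g w)) w) = 0" using split by simp
    then have ug: "u (g w) = 0" if "w \<in> W" for w
      using vs2.independentD[OF W(1,2) order.refl, of "\<lambda>w. u (g w)"] that by blast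
    have "(\<Sum>x\<in>K. s1 (u x) x) = 0"
      using split by (simp add: uh ug)
    then have "u x = 0" if "x \<in> K" for x
      using vs1.independentD[OF K(1,2) order.refl] that by blast
    then show "u x = 0" using x uh ug by blast
  qed
qed

text \<open>Subtracting from \<open>x\<close> a combination of the preimages with the same values
  under \<open>A\<close> and \<open>B\<close> leaves a vector of the common kernel, which
  \<open>K\<close> spans.\<close>

lemma span_kernel_preimages:
  assumes linA: "Vector_Spaces.linear s1 s2 A" and linB: "Vector_Spaces.linear s1 s2 B"
    and U: "vs1.subspace U" and AB: "\<And>x. x \<in> U \<Longrightarrow> A x \<in> vs2.span W" "\<And>x. x \<in> U \<Longrightarrow> B x \<in> vs2.span W"
    and K: "vs1.span K = {x \<in> U. A x = 0 \<and> B x = 0}"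
    and W: "finite W"
    and g: "\<And>w. w \<in> W \<Longrightarrow> g w \<in> U" "\<And>w. w \<in> W \<Longrightarrow> A (g w) = 0" "\<And>w. w \<in> W \<Longrightarrow> B (g w) = w"
    and h: "\<And>w. w \<in> W \<Longrightarrow> h w \<in> U" "\<And>w. w \<in> W \<Longrightarrow> A (h w) = w" "\<And>w. w \<in> W \<Longrightarrow> B (h w) = 0"
  shows "vs1.span (K \<union> g ` W \<union> h ` W) = U"
proof -
  interpret A: Vector_Spaces.linear s1 s2 A by fact
  interpret B: Vector_Spaces.linear s1 s2 B by fact
  have KU: "K \<subseteq> U" using K vs1.span_superset by blast
  show ?thesis
  proof (rule vs1.span_subspace[OF _ _ U])
    show "K \<union> g ` W \<union> h ` W \<subseteq> U" using KU g(1) h(1) by auto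
    show "U \<subseteq> vs1.span (K \<union> g ` W \<union> h ` W)" (is "_ \<subseteq> vs1.span ?S")
    proof
      fix x assume x: "x \<in> U"
      obtain \<alpha> where \<alpha>: "A x = (\<Sum>w\<in>W. s2 (\<alpha> w) w)" using AB(1)[OF x] vs2.span_finite[OF W] by auto
      obtain \<beta> where \<beta>: "B x = (\<Sum>w\<in>W. s2 (\<beta> w) w)" using AB(2)[OF x] vs2.span_finite[OF W] by auto
      \<comment> \<open>\<open>g\<close> carries the coordinates of \<open>B x\<close> and
        \<open>h\<close> those of \<open>A x\<close>, as \<open>g w\<close> maps to
        \<open>(0, w)\<close> and \<open>h w\<close> to \<open>(w, 0)\<close>.\<close>
      define y where "y = (\<Sum>w\<in>W. s1 (\<beta> w) (g w)) + (\<Sum>w\<in>W. s1 (\<alpha> w) (h w))"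
      have yU: "y \<in> U" unfolding y_def
        by (intro vs1.subspace_add vs1.subspace_sum vs1.subspace_scale U g h)
      have "A y = A x" "B y = B x"
        unfolding y_def \<alpha> \<beta> using g h by (simp_all add: A.add A.sum A.scale B.add B.sum B.scale)
      then have "x - y \<in> vs1.span K"
        unfolding K using x yU by (simp add: A.diff B.diff vs1.subspace_diff[OF U])
      then have "x - y \<in> vs1.span ?S"
        using vs1.span_mono[of K ?S] by auto
      moreover have "y \<in> vs1.span ?S" unfolding y_def
        by (intro vs1.span_add vs1.span_sum vs1.span_scale vs1.span_base) auto
      ultimately have "(x - y) + y \<in> vs1.span ?S" by (rule vs1.span_add)
      then show "x \<in> vs1.span ?S" by simp
    qed
  qed
qed

end

lemma type_of_horizontal_blocks:
  "type_of_blocks (replicate k (Horizontal 1) @ replicate d (Horizontal 2)) =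
     \<lparr> jordan_part = {#}, horizontal_indices = replicate_mset k 1 + replicate_mset d 2,
       vertical_indices = {#} \<rparr>"
proof -
  let ?bs = "replicate k (Horizontal 1) @ replicate d (Horizontal 2)"
  have 1: "block_eigenvalues ?bs = {}" by (auto simp: block_eigenvalues_def)
  note no_ev = 1[unfolded One_nat_def]
  have 2: "mset [h. Horizontal h \<leftarrow> replicate k (Horizontal j)] = replicate_mset k j" for k j
    by (induction k) auto
  have 3: "[v. Vertical v \<leftarrow> replicate k (Horizontal j)] = []" for k j
    by (induction k) auto
  show ?thesis
    by (simp add: type_of_blocks_def no_ev 2 3)
qed

text \<open>The algebraic type is defined for complex scalars only, so the scalar field is fixed
  here.\<close>

locale complex_vector_space_pair =
  finite_dimensional_vector_space_pair s1 B1 s2 B2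
  for s1 :: "complex \<Rightarrow> 'a :: ab_group_add \<Rightarrow> 'a" and B1
    and s2 :: "complex \<Rightarrow> 'b :: ab_group_add \<Rightarrow> 'b" and B2

text \<open>Each basis vector of \<open>V\<close> gives one block of width 2 and uses two dimensions
  of \<open>U\<close>; the rest is the dimension of the common kernel. Surjectivity ensures
  \<open>2 * vs2.dim V \<le> vs1.dim U\<close>, so the subtraction of naturals is exact.\<close>

lemma (in complex_vector_space_pair) has_algebraic_type_of_surjective:
  assumes linA: "Vector_Spaces.linear s1 s2 A" and linB: "Vector_Spaces.linear s1 s2 B"
    and U: "vs1.subspace U" and V: "vs2.subspace V"
    and AV: "\<And>x. x \<in> U \<Longrightarrow> A x \<in> V" and BV: "\<And>x. x \<in> U \<Longrightarrow> B x \<in> V"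
    and surj: "\<And>v w. v \<in> V \<Longrightarrow> w \<in> V \<Longrightarrow> \<exists>x\<in>U. A x = v \<and> B x = w"
  shows "has_algebraic_type s1 U s2 V A B
    \<lparr> jordan_part = {#},
      horizontal_indices = replicate_mset (vs1.dim U - 2 * vs2.dim V) 1 + replicate_mset (vs2.dim V) 2,
      vertical_indices = {#} \<rparr>"
proof -
  interpret A: Vector_Spaces.linear s1 s2 A by fact
  interpret B: Vector_Spaces.linear s1 s2 B by fact
  obtain W where W: "W \<subseteq> V" "vs2.independent W" "V \<subseteq> vs2.span W" "card W = vs2.dim V"
    using vs2.basis_exists[of V] by metis
  have finW: "finite W" using W(2) vs2.finiteI_independent by blast
  have spanW: "vs2.span W = V" using vs2.span_subspace[OF W(1,3) V] .
  obtain g where g: "\<And>w. w \<in> W \<Longrightarrow> g w \<in> U \<and> A (g w) = 0 \<and> B (g w) = w"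
    using surj[OF vs2.subspace_0[OF V]] W(1) by (metis subsetD)
  obtain h where h: "\<And>w. w \<in> W \<Longrightarrow> h w \<in> U \<and> A (h w) = w \<and> B (h w) = 0"
    using surj[OF _ vs2.subspace_0[OF V]] W(1) by (metis subsetD)
  let ?N = "{x \<in> U. A x = 0 \<and> B x = 0}"
  have N: "vs1.subspace ?N"
    by (rule vs1.subspaceI)
      (auto simp: A.add B.add A.scale B.scale vs1.subspace_0 vs1.subspace_add vs1.subspace_scale U)
  obtain K where K: "K \<subseteq> ?N" "vs1.independent K" "?N \<subseteq> vs1.span K"
    by (rule vs1.basis_exists[of ?N])
  have finK: "finite K" using K(2) vs1.finiteI_independent by blast
  have spanK: "vs1.span K = ?N" using vs1.span_subspace[OF K(1,3) N] .
  let ?S = "K \<union> g ` W \<union> h ` W"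
  have Ker: "A x = 0" "B x = 0" if "x \<in> K" for x
    using K(1) that by auto
  have gs: "g w \<in> U" "A (g w) = 0" "B (g w) = w" if "w \<in> W" for w
    using g that by auto
  have hs: "h w \<in> U" "A (h w) = w" "B (h w) = 0" if "w \<in> W" for w
    using h that by auto
  note indep = independent_kernel_preimages[OF linA linB K(2) finK Ker W(2) finW gs(2,3) hs(2,3)]
  have span: "vs1.span ?S = U"
    by (rule span_kernel_preimages[OF linA linB U _ _ spanK finW]) (use gs hs AV BV spanW in auto)
  obtain ks where ks: "set ks = K" "distinct ks" using finite_distinct_list[OF finK] by blast
  obtain ws where ws: "set ws = W" "distinct ws" using finite_distinct_list[OF finW] by blast
  define us where "us = ks @ concat (map (\<lambda>w. [g w, h w]) ws)"
  have set_us: "set us = ?S" unfolding us_def using ks ws by auto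
  have card_us: "length us = length ks + 2 * length ws"
    unfolding us_def by (induction ws) simp_all
  \<comment> \<open>\<open>us\<close> has no repetitions because its length equals the cardinality
    of its set, by the disjointness and injectivity in \<open>indep\<close>.\<close>
  have "card ?S = card K + card W + card W"
    using indep finK finW by (simp add: card_Un_disjoint card_image)
  then have "card (set us) = length us"
    using set_us card_us ks ws by (simp add: distinct_card[symmetric])
  then have dist: "distinct us" by (rule card_distinct)
  have "length us = vs1.dim U"
    using dist indep(1) span set_us vs1.dim_span_eq_card_independent[of ?S]
    by (metis distinct_card vs1.dim_span)
  moreover have lw: "length ws = vs2.dim V" using ws W(4) distinct_card by metis
  ultimately have lk: "length ks = vs1.dim U - 2 * vs2.dim V" using card_us by simp
  define bs where "bs = replicate (length ks) (Horizontal 1) @ replicate (length ws) (Horizontal 2)"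
  note rep = represents_horizontal_blocks[of s2 ks A B ws g h, folded us_def bs_def]
  have "represents s2 us ws (diag_block_mat (map block_A bs)) A"
    by (rule rep(1)) (use ks(1) ws(1) Ker gs hs in simp_all)
  moreover have "represents s2 us ws (diag_block_mat (map block_B bs)) B"
    by (rule rep(2)) (use ks(1) ws(1) Ker gs hs in simp_all)
  moreover have "is_basis_list s1 U us" "is_basis_list s2 V ws"
    using dist set_us indep(1) span ws W(2) spanW by (simp_all add: is_basis_list_def)
  moreover have "\<forall>b\<in>set bs. block_size b \<ge> 1" unfolding bs_def by auto
  ultimately have "has_kronecker_form s1 U s2 V A B bs"
    unfolding has_kronecker_form_def by blast
  moreover have "type_of_blocks bs =
    \<lparr> jordan_part = {#},
      horizontal_indices = replicate_mset (vs1.dim U - 2 * vs2.dim V) 1 + replicate_mset (vs2.dim V) 2,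
      vertical_indices = {#} \<rparr>"
    unfolding bs_def lk lw by (rule type_of_horizontal_blocks)
  ultimately show ?thesis
    unfolding has_algebraic_type_def by metis
qed

subsection \<open>Dimensions\<close>

interpretation cmat: vector_space "cmat_scale :: complex \<Rightarrow> complex^'m^'k \<Rightarrow> complex^'m^'k"
  by (rule vector_space_cmat_scale)

section \<open>Independence and dimension for indexed families\<close>

context vector_space
begin

text \<open>Two indices with the same vector would give a relation with coefficients 1 and -1. So
  the hypothesis on coefficients also forces injectivity, and the family may be treated as a set of
  the same size.\<close>

lemma independent_image_of_coordinates:
  assumes fin: "finite I"
    and zero: "\<And>u i. (\<Sum>i\<in>I. scale (u i) (e i)) = 0 \<Longrightarrow> i \<in> I \<Longrightarrow> u i = 0"
  shows "inj_on e I" "independent (e ` I)"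
proof -
  show inj: "inj_on e I"
  proof (rule inj_onI, rule ccontr)
    fix i j assume ij: "i \<in> I" "j \<in> I" "e i = e j" "i \<noteq> j"
    let ?u = "\<lambda>k. (if k = i then 1 else 0) - (if k = j then 1 else 0)"
    have "(\<Sum>k\<in>I. scale (?u k) (e k)) =
        (\<Sum>k\<in>I. if k = i then e k else 0) - (\<Sum>k\<in>I. if k = j then e k else 0)"
      unfolding sum_subtractf[symmetric] by (rule sum.cong) (auto simp: scale_left_diff_distrib)
    also have "\<dots> = 0" using ij fin by simp
    finally show False using zero[of ?u i, OF _ ij(1)] ij(4) by simp
  qed
  show "independent (e ` I)"
  proof (rule independent_if_scalars_zero)
    fix u x assume "(\<Sum>x\<in>e ` I. scale (u x) x) = 0" "x \<in> e ` I"
    then show "u x = 0"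
      using zero[of "\<lambda>i. u (e i)"] inj by (auto simp: sum.reindex)
  qed (use fin in simp)
qed

lemma dim_eq_card_coordinates:
  assumes fin: "finite I"
    and zero: "\<And>u i. (\<Sum>i\<in>I. scale (u i) (e i)) = 0 \<Longrightarrow> i \<in> I \<Longrightarrow> u i = 0"
    and mem: "\<And>i. i \<in> I \<Longrightarrow> e i \<in> V"
    and coords: "\<And>x. x \<in> V \<Longrightarrow> x = (\<Sum>i\<in>I. scale (c x i) (e i))"
  shows "dim V = card I"
proof (rule dim_unique)
  show "e ` I \<subseteq> V" using mem by auto
  show "V \<subseteq> span (e ` I)"
  proof
    fix x assume "x \<in> V"
    moreover have "(\<Sum>i\<in>I. scale (c x i) (e i)) \<in> span (e ` I)"
      by (intro span_sum span_scale span_base imageI)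
    ultimately show "x \<in> span (e ` I)" using coords by simp
  qed
  show "independent (e ` I)" "card (e ` I) = card I"
    using independent_image_of_coordinates[of I e] fin zero by (auto simp: card_image)
qed

end

text \<open>These are the elementary matrices, taken with a pair as argument so that the type of
  positions itself indexes the standard basis.\<close>

definition unit_mat :: "'m \<times> 'm \<Rightarrow> complex^'m^'m" where
  "unit_mat p = (\<chi> a b. if p = (a, b) then 1 else 0)"

lemma sum_unit_mat_nth:
  assumes "finite I"
  shows "(\<Sum>p\<in>I. cmat_scale (u p) (unit_mat p)) $ a $ b = (if (a, b) \<in> I then u (a, b) else 0)"
proof -
  have "(\<Sum>p\<in>I. cmat_scale (u p) (unit_mat p)) $ a $ b
      = (\<Sum>p\<in>I. if p = (a, b) then u p else 0)"
    unfolding sum_component by (rule sum.cong) (auto simp: cmat_scale_def unit_mat_def)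
  then show ?thesis using assms by simp
qed

lemma matrix_eq_sum_unit_mat:
  "(X :: complex^'m^'m) = (\<Sum>p\<in>UNIV. cmat_scale (X $ fst p $ snd p) (unit_mat p))"
  by (simp add: Finite_Cartesian_Product.vec_eq_iff sum_unit_mat_nth del: sum_component)

lemma unit_mat_coordinates:
  assumes "(\<Sum>p\<in>UNIV. cmat_scale (u p) (unit_mat p)) = (0 :: complex^'m^'m)"
  shows "u p = 0"
  using arg_cong[OF assms, of "\<lambda>X. X $ fst p $ snd p"] by (simp add: sum_unit_mat_nth del: sum_component)

interpretation cmat: finite_dimensional_vector_space
  "cmat_scale :: complex \<Rightarrow> complex^'m^'m \<Rightarrow> complex^'m^'m" "range unit_mat"
proof
  show "finite (range (unit_mat :: 'm \<times> 'm \<Rightarrow> _))" by simp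
  show "cmat.independent (range (unit_mat :: 'm \<times> 'm \<Rightarrow> _))"
    by (rule cmat.independent_image_of_coordinates) (auto intro: unit_mat_coordinates)
  show "cmat.span (range (unit_mat :: 'm \<times> 'm \<Rightarrow> _)) = UNIV"
  proof (intro UNIV_eq_I[symmetric])
    fix X :: "complex^'m^'m"
    have "(\<Sum>p\<in>UNIV. cmat_scale (X $ fst p $ snd p) (unit_mat p)) \<in> cmat.span (range unit_mat)"
      by (intro cmat.span_sum cmat.span_scale cmat.span_base) auto
    then show "X \<in> cmat.span (range unit_mat)"
      using matrix_eq_sum_unit_mat[of X] by simp
  qed
qed

lemma dim_gl: "cmat.dim (gl :: (complex^'m^'m) set) = CARD('m) ^ 2"
proof -
  have "cmat.dim (UNIV :: (complex^'m^'m) set) = card (UNIV :: ('m \<times> 'm) set)"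
    by (rule cmat.dim_eq_card_coordinates) (auto intro: unit_mat_coordinates matrix_eq_sum_unit_mat)
  then show ?thesis by (simp add: gl_def power2_eq_square)
qed

lemma trace_cmat_scale: "trace (cmat_scale c X) = c * trace X"
  by (simp add: trace_def cmat_scale_def sum_distrib_left)

lemma trace_zero: "trace 0 = 0"
  by (simp add: trace_def)

lemma subspace_sl: "cmat.subspace (sl :: (complex^'m^'m) set)"
  by (rule cmat.subspaceI) (auto simp: sl_def trace_add trace_cmat_scale trace_zero)

text \<open>The identity has nonzero trace and hence spans a complement of \<open>sl\<close>;
  adjoining it to a basis of \<open>sl\<close> gives a basis of \<open>gl\<close>.\<close>

lemma dim_sl: "cmat.dim (sl :: (complex^'m^'m) set) = CARD('m) ^ 2 - 1"
proof -
  let ?I = "Finite_Cartesian_Product.mat 1 :: complex^'m^'m"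
  obtain B :: "(complex^'m^'m) set" where B: "B \<subseteq> sl" "cmat.independent B" "sl \<subseteq> cmat.span B"
    "card B = cmat.dim (sl :: (complex^'m^'m) set)"
    by (rule cmat.basis_exists)
  have span: "cmat.span B = sl"
    using cmat.span_subspace[OF B(1,3) subspace_sl] .
  have "?I \<notin> cmat.span B"
    unfolding span by (simp add: sl_def trace_I)
  then have indep: "cmat.independent (insert ?I B)" and notin: "?I \<notin> B"
    using B(2) cmat.independent_insertI cmat.span_base by blast+
  have "X \<in> cmat.span (insert ?I B)" for X
  proof -
    \<comment> \<open>The coefficient is chosen to make the difference traceless.\<close>
    have "X - cmat_scale (trace X / of_nat CARD('m)) ?I \<in> cmat.span B"
      unfolding span by (simp add: sl_def trace_sub trace_cmat_scale trace_I)
    then show ?thesis using cmat.span_breakdown_eq by blast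
  qed
  then have "cmat.span (insert ?I B) = gl" unfolding gl_def by blast
  then have "card (insert ?I B) = CARD('m) ^ 2"
    using cmat.dim_span_eq_card_independent[OF indep] dim_gl by metis
  moreover have "finite B" using B(2) cmat.finiteI_independent by blast
  ultimately show ?thesis using B(4) notin by simp
qed

lemma skew_forms_iff: "Q \<in> skew_forms \<longleftrightarrow> (\<forall>i j. Q $ j $ i = - Q $ i $ j)"
  by (simp only: skew_forms_def Finite_Cartesian_Product.transpose_def mem_Collect_eq
      Finite_Cartesian_Product.vec_eq_iff vec_lambda_beta vector_uminus_component)

lemma skew_formsD: "Q \<in> skew_forms \<Longrightarrow> Q $ i $ j = - Q $ j $ i"
  unfolding skew_forms_iff by blast

lemma skew_formsI: "(\<And>i j. Q $ i $ j = - Q $ j $ i) \<Longrightarrow> Q \<in> skew_forms"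
  unfolding skew_forms_iff by blast

lemma subspace_skew_forms: "cmat.subspace (skew_forms :: (complex^'m^'m) set)"
proof (rule cmat.subspaceI)
  fix x y :: "complex^'m^'m"
  assume x: "x \<in> skew_forms" and y: "y \<in> skew_forms"
  show "x + y \<in> skew_forms"
    by (rule skew_formsI, simp, subst skew_formsD[OF x], subst skew_formsD[OF y]) simp
next
  fix c :: complex and x :: "complex^'m^'m"
  assume x: "x \<in> skew_forms"
  show "cmat_scale c x \<in> skew_forms"
    unfolding cmat_scale_def by (rule skew_formsI, simp, subst skew_formsD[OF x]) simp
qed (rule skew_formsI, simp)

text \<open>The positions of a matrix split into those above the diagonal, their mirror images and
  the diagonal; those above it index a basis. The additive form avoids division and subtraction of
  naturals.\<close>

lemma dim_skew_forms: "2 * cmat.dim (skew_forms :: (complex^'m^'m) set) + CARD('m) = CARD('m) ^ 2"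
proof -
  \<comment> \<open>The index type carries no order; an injection into the naturals supplies one, to
    say what lies above the diagonal.\<close>
  obtain g :: "'m \<Rightarrow> nat" where g: "inj g"
    using finite_imp_inj_to_nat_seg[of "UNIV :: 'm set"] by auto
  define I where "I = {p :: 'm \<times> 'm. g (fst p) < g (snd p)}"
  define e where "e p = unit_mat p - unit_mat (prod.swap p)" for p :: "'m \<times> 'm"
  have e_nth: "e p $ a $ b = (if p = (a, b) then 1 else 0) - (if p = (b, a) then 1 else 0)" for p a b
    by (cases p) (simp only: e_def unit_mat_def vector_minus_component vec_lambda_beta prod.swap_def
        fst_conv snd_conv prod.inject conj_commute)
  have nth: "(\<Sum>p\<in>I. cmat_scale (u p) (e p)) $ a $ b =
      (if (a, b) \<in> I then u (a, b) else 0) - (if (b, a) \<in> I then u (b, a) else 0)" for u a b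
  proof -
    have "(\<Sum>p\<in>I. cmat_scale (u p) (e p)) $ a $ b =
      (\<Sum>p\<in>I. if p = (a, b) then u p else 0) - (\<Sum>p\<in>I. if p = (b, a) then u p else 0)"
    proof -
      have "cmat_scale (u p) (e p) $ a $ b = (if p = (a, b) then u p else 0) - (if p = (b, a) then u p else 0)" for p
        by (simp only: cmat_scale_def vec_lambda_beta e_nth right_diff_distrib if_distrib[of "(*) (u p)"] mult_1_right mult_zero_right)
      then show ?thesis by (simp only: sum_component sum_subtractf)
    qed
    then show ?thesis by simp
  qed
  have asym: "(b, a) \<notin> I" if "(a, b) \<in> I" for a b
    using that by (simp add: I_def)
  have "cmat.dim (skew_forms :: (complex^'m^'m) set) = card I"
  proof (rule cmat.dim_eq_card_coordinates[where c = "\<lambda>X p. X $ fst p $ snd p"])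
    show "e p \<in> skew_forms" for p
      by (rule skew_formsI) (simp only: e_nth minus_diff_eq)
    show "u p = 0" if "(\<Sum>p\<in>I. cmat_scale (u p) (e p)) = 0" "p \<in> I" for u p
    proof -
      have "(fst p, snd p) \<in> I" "(snd p, fst p) \<notin> I"
        using that(2) asym by auto
      then show ?thesis
        using nth[of u "fst p" "snd p"] unfolding that(1) by simp
    qed
    show "X = (\<Sum>p\<in>I. cmat_scale (X $ fst p $ snd p) (e p))" if "X \<in> skew_forms" for X
    proof -
      have "X $ a $ b = (\<Sum>p\<in>I. cmat_scale (X $ fst p $ snd p) (e p)) $ a $ b" for a b
      proof -
        consider "(a, b) \<in> I" | "(b, a) \<in> I" | "a = b"
          using g by (auto simp: I_def inj_def) (metis nat_neq_iff)
        then show ?thesis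
        proof cases
          case 1
          then show ?thesis using asym by (simp add: nth del: sum_component)
        next
          case 2
          then show ?thesis
            using asym[of b a] skew_formsD[OF that, of a b] by (simp add: nth del: sum_component)
        next
          case 3
          then show ?thesis
            using skew_formsD[OF that, of a b] by (simp add: nth del: sum_component)
        qed
      qed
      then show ?thesis unfolding Finite_Cartesian_Product.vec_eq_iff by blast
    qed
  qed simp
  moreover have "card (UNIV :: ('m \<times> 'm) set) = card I + card (prod.swap ` I) + card (range (\<lambda>a :: 'm. (a, a)))"
  proof -
    have "UNIV = (I \<union> prod.swap ` I) \<union> range (\<lambda>a. (a, a))"
      using g unfolding I_def inj_def by (auto simp: image_iff)
    moreover have "I \<inter> prod.swap ` I = {}" "(I \<union> prod.swap ` I) \<inter> range (\<lambda>a. (a, a)) = {}"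
      by (auto simp: I_def)
    ultimately show ?thesis by (simp add: card_Un_disjoint[symmetric])
  qed
  moreover have "card (prod.swap ` I) = card I" "card (range (\<lambda>a :: 'm. (a, a))) = CARD('m)"
    by (auto intro!: card_image inj_onI)
  ultimately show ?thesis by (simp add: power2_eq_square)
qed

subsection \<open>A generic pair of forms\<close>

text \<open>Walking along the antidiagonal from \<open>(x, y)\<close> to \<open>(y, x)\<close> keeps
  the value, while skew-symmetry negates it.\<close>

lemma alternating_const_antidiagonals_eq_0:
  fixes f :: "nat \<Rightarrow> nat \<Rightarrow> complex"
  assumes skew: "\<And>x y. f x y = - f y x"
    and shift: "\<And>x y. x < n \<Longrightarrow> y < n \<Longrightarrow> f x (Suc y) = f (Suc x) y"
    and "x \<le> n" "y \<le> n"
  shows "f x y = 0"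
proof -
  have move: "f x y = f (x + d) (y - d)" if "d \<le> y" "x + d \<le> n" "y \<le> n" for x y d
    using that
  proof (induction d)
    case (Suc d)
    then have "f (x + d) (Suc (y - Suc d)) = f (Suc (x + d)) (y - Suc d)"
      by (intro shift) auto
    moreover have "Suc (y - Suc d) = y - d" using Suc.prems by simp
    ultimately show ?case using Suc by simp
  qed simp
  have le: "f x y = 0" if "x \<le> y" "y \<le> n" for x y
    using move[of "y - x" y x] skew[of x y] that by simp
  show ?thesis
    using le[of x y] le[of y x] skew[of x y] assms(3,4) by (cases "x \<le> y") auto
qed

text \<open>
  The functions \<open>P\<close> and \<open>Q\<close> are skew-symmetric matrices extended by zero, and the equations say
  that \<open>a P + b Q = c I\<close>, where \<open>a\<close> and \<open>b\<close> are the forms given by the even and the odd edges of the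
  path \<open>0, \<dots>, 2 n\<close>.
\<close>

lemma path_pencil_annihilator:
  fixes P Q :: "nat \<Rightarrow> nat \<Rightarrow> complex"
  assumes skewP: "\<And>i j. P i j = - P j i" and skewQ: "\<And>i j. Q i j = - Q j i"
    and outP: "\<And>i j. 2 * n < i \<Longrightarrow> P i j = 0" and outQ: "\<And>i j. 2 * n < i \<Longrightarrow> Q i j = 0"
    and first: "\<And>j. j \<le> 2 * n \<Longrightarrow> P 1 j = (if j = 0 then c else 0)"
    and even: "\<And>x j. x < n \<Longrightarrow> j \<le> 2 * n \<Longrightarrow>
      P (2 * x + 3) j - Q (2 * x + 1) j = (if j = 2 * x + 2 then c else 0)"
    and odd: "\<And>x j. x < n \<Longrightarrow> j \<le> 2 * n \<Longrightarrow>
      Q (2 * x + 2) j - P (2 * x) j = (if j = 2 * x + 1 then c else 0)"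
  shows "P i j = 0" "Q i j = 0"
proof -
  have outP': "P i j = 0" if "2 * n < j" for i j
    using outP[OF that] skewP[of i j] by simp
  have outQ': "Q i j = 0" if "2 * n < j" for i j
    using outQ[OF that] skewQ[of i j] by simp
  have par: "2 * x + 1 \<noteq> 2 * y + 2" "2 * x + 1 \<noteq> 2 * y" "2 * y \<noteq> 2 * x + 1" "2 * y + 2 \<noteq> 2 * x + 1"
    for x y :: nat
    by presburger+
  \<comment> \<open>In odd columns, parity makes the right-hand side of \<open>even\<close> zero.
    Both entries of \<open>P\<close> then equal \<open>Q (2 * x + 1) (2 * y + 1)\<close>, the second
    one by skew-symmetry.\<close>
  have oo_shift: "P (2 * x + 3) (2 * y + 1) = P (2 * x + 1) (2 * y + 3)" if "x < n" "y < n" for x y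
    using even[of x "2 * y + 1"] even[of y "2 * x + 1"] skewQ[of "2 * x + 1" "2 * y + 1"]
      skewP[of "2 * x + 1" "2 * y + 3"] that par
    by (simp add: eq_neg_iff_add_eq_0) (metis add_right_cancel)
  \<comment> \<open>An antidiagonal of odd positions is followed back to row 1, where
    \<open>first\<close> gives zero, unless it leaves the matrix before.\<close>
  have oo: "P (2 * x + 1) (2 * y + 1) = 0" for x y
  proof (induction x arbitrary: y)
    case 0
    show ?case
    proof (cases "y < n")
      case True
      then show ?thesis using first[of "2 * y + 1"] by simp
    next
      case False
      then show ?thesis by (simp add: outP')
    qed
  next
    case (Suc x)
    show ?case
    proof (cases "x < n \<and> y < n")
      case True
      then show ?thesis using oo_shift[of x y] Suc[of "Suc y"] by (simp add: numeral_3_eq_3)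
    next
      case False
      then show ?thesis by (auto simp: outP outP')
    qed
  qed
  \<comment> \<open>The same elimination of \<open>Q\<close>, now with \<open>odd\<close> in even
    columns.\<close>
  have ee_shift: "P (2 * x) (2 * Suc y) = P (2 * Suc x) (2 * y)" if "x < n" "y < n" for x y
    using odd[of x "2 * Suc y"] odd[of y "2 * Suc x"] skewQ[of "2 * x + 2" "2 * y + 2"]
      skewP[of "2 * x + 2" "2 * y"] that par by simp
  have ee: "P (2 * x) (2 * y) = 0" for x y
  proof (cases "x \<le> n \<and> y \<le> n")
    case True
    then show ?thesis
      using alternating_const_antidiagonals_eq_0[of "\<lambda>x y. P (2 * x) (2 * y)" n x y] skewP ee_shift
      by blast
  next
    case False
    then show ?thesis by (auto simp: outP outP')
  qed
  \<comment> \<open>For mixed parity, \<open>odd\<close> and \<open>even\<close> have the same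
    right-hand side, which is \<open>c\<close> when \<open>x = y\<close> and zero otherwise.
    Skew-symmetry of \<open>Q\<close> cancels it, so here \<open>P\<close> is constant along
    diagonals.\<close>
  have eo_shift: "P (2 * Suc x) (2 * Suc y + 1) = P (2 * x) (2 * y + 1)" if "x < n" "y < n" for x y
  proof -
    have "Q (2 * x + 2) (2 * y + 1) - P (2 * x) (2 * y + 1) = (if x = y then c else 0)"
      using odd[of x "2 * y + 1"] that by auto
    moreover have "P (2 * y + 3) (2 * x + 2) - Q (2 * y + 1) (2 * x + 2) = (if x = y then c else 0)"
      using even[of y "2 * x + 2"] that by auto
    moreover have "Q (2 * x + 2) (2 * y + 1) = - Q (2 * y + 1) (2 * x + 2)"
      by (rule skewQ)
    moreover have "- p' = p" if eqs: "q - p = d" "p' - q' = d" "q = - q'" for p p' q q' d :: complex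
    proof -
      have "q' = - (d + p)" using eqs(1,3) by (metis diff_add_cancel add.commute minus_minus)
      then show ?thesis using eqs(2) by (simp add: diff_eq_eq)
    qed
    ultimately have "- P (2 * y + 3) (2 * x + 2) = P (2 * x) (2 * y + 1)"
      by blast
    then show ?thesis
      using skewP[of "2 * x + 2" "2 * y + 3"] by (simp add: numeral_3_eq_3)
  qed
  have eo_diag: "P (2 * x) (2 * (x + y) + 1) = P 0 (2 * y + 1)" if "x + y \<le> n" for x y
    using that
  proof (induction x)
    case (Suc x)
    then show ?case using eo_shift[of x "x + y"] by simp
  qed simp
  \<comment> \<open>With \<open>x = n - y\<close>, the diagonal from row 0 ends in column
    \<open>2 * n + 1\<close>, the first one outside the matrix.\<close>
  have eo_0: "P 0 (2 * y + 1) = 0" for y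
  proof (cases "y \<le> n")
    case True
    then show ?thesis using eo_diag[of "n - y" y] by (simp add: outP')
  next
    case False
    then show ?thesis by (simp add: outP')
  qed
  \<comment> \<open>The entry of \<open>P\<close> at \<open>(1, 0)\<close> is \<open>c\<close> by
    \<open>first\<close>, and the entry at \<open>(0, 1)\<close> has just been shown to
    vanish.\<close>
  have c: "c = 0"
    using first[of 0] eo_0[of 0] skewP[of 0 1] by simp
  \<comment> \<open>Diagonals starting in row 0 are settled by \<open>eo_0\<close>; the others start
    in column 1, where \<open>first\<close> and skew-symmetry give zero.\<close>
  have eo: "P (2 * x) (2 * y + 1) = 0" for x y
  proof (induction x arbitrary: y)
    case 0
    then show ?case using eo_0 by simp
  next
    case (Suc x)
    show ?case
    proof (cases "x < n \<and> 0 < y \<and> y \<le> n")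
      case True
      then have "x < n" "y - 1 < n" "Suc (y - 1) = y" by auto
      then show ?thesis using eo_shift[of x "y - 1"] Suc[of "y - 1"] by simp
    next
      case False
      then consider "n \<le> x" | "n < y" | "y = 0" "x < n" by linarith
      then show ?thesis
        using first[of "2 * Suc x"] skewP[of "2 * Suc x" 1] c
        by cases (auto simp: outP outP')
    qed
  qed
  have P0: "P i j = 0" for i j
  proof -
    have "\<exists>x. i = 2 * x \<or> i = 2 * x + 1" "\<exists>y. j = 2 * y \<or> j = 2 * y + 1"
      by presburger+
    then show ?thesis
      using oo ee eo skewP[of i j] by force
  qed
  then show "P i j = 0" .
  \<comment> \<open>With \<open>P\<close> and \<open>c\<close> zero, \<open>even\<close> and
    \<open>odd\<close> annihilate every row of \<open>Q\<close> except row 0, which then follows by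
    skew-symmetry.\<close>
  have odd_row: "Q (2 * x + 1) j = 0" for x j
    using even[of x j] P0 c outQ outQ' by (cases "x < n"; cases "j \<le> 2 * n") auto
  have even_row: "Q (2 * x + 2) j = 0" for x j
    using odd[of x j] P0 c outQ outQ' by (cases "x < n"; cases "j \<le> 2 * n") auto
  have row: "Q i j = 0" if "i \<noteq> 0" for i j
  proof -
    have "\<exists>x. i = 2 * x + 1 \<or> i = 2 * x + 2"
      using that by presburger
    then show ?thesis using odd_row even_row by blast
  qed
  show "Q i j = 0"
    using row[of i j] row[of j i] skewQ[of i j] by (cases "i = 0"; cases "j = 0") auto
qed

section \<open>Duality for the trace form\<close>

lemma trace_mult_unit_mat: "trace (M ** unit_mat (i, j)) = M $ j $ i"
proof -
  have "(M ** unit_mat (i, j)) $ a $ a = (if a = j then M $ a $ i else 0)" for a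
  proof -
    have "(M ** unit_mat (i, j)) $ a $ a = (\<Sum>b\<in>UNIV. if b = i then (if a = j then M $ a $ b else 0) else 0)"
      unfolding matrix_matrix_mult_def unit_mat_def vec_lambda_beta by (rule sum.cong) auto
    then show ?thesis by simp
  qed
  then show ?thesis by (simp add: trace_def)
qed

text \<open>Testing against \<open>unit_mat (i, j)\<close> with \<open>i \<noteq> j\<close> kills
  the off-diagonal entries; testing against differences of diagonal units makes the diagonal
  constant.\<close>

lemma scalar_of_trace_orthogonal_sl:
  fixes M :: "complex^'m^'m"
  assumes "\<And>X. X \<in> sl \<Longrightarrow> trace (M ** X) = 0"
  shows "\<exists>c. M = Finite_Cartesian_Product.mat c"
proof -
  have trace_unit: "trace (unit_mat (i, j) :: complex^'m^'m) = (if i = j then 1 else 0)" for i j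
  proof -
    have "trace (unit_mat (i, j) :: complex^'m^'m) = (\<Sum>a\<in>UNIV. if a = i then (if i = j then 1 else 0) else 0)"
      unfolding trace_def unit_mat_def by (intro sum.cong) auto
    then show ?thesis by simp
  qed
  have off: "M $ j $ i = 0" if "i \<noteq> j" for i j
    using assms[of "unit_mat (i, j)"] that by (simp add: sl_def trace_unit trace_mult_unit_mat)
  have diag: "M $ i $ i = M $ j $ j" for i j
  proof -
    have "trace (M ** (unit_mat (i, i) - unit_mat (j, j))) = 0"
      by (rule assms) (simp add: sl_def trace_sub trace_unit)
    moreover have "M ** (A - B) = M ** A - M ** B" for A B :: "complex^'m^'m"
      by (simp add: matrix_matrix_mult_def Finite_Cartesian_Product.vec_eq_iff
          right_diff_distrib sum_subtractf)
    ultimately show ?thesis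
      by (simp add: trace_sub trace_mult_unit_mat)
  qed
  \<comment> \<open>\<open>undefined\<close> stands for an arbitrary index at which the common
    diagonal entry is read off.\<close>
  have "M = Finite_Cartesian_Product.mat (M $ undefined $ undefined)"
    using off diag by (auto simp: Finite_Cartesian_Product.vec_eq_iff Finite_Cartesian_Product.mat_def)
  then show ?thesis by blast
qed

text \<open>This computes the adjoint of the map that sends \<open>X\<close> to
  \<open>congruence_rep X a\<close>. Its two summands contribute equally: the first by cyclicity of
  the trace, the second by invariance of the trace under transposition as well.\<close>

lemma trace_pairing_congruence_rep:
  assumes "p \<in> skew_forms" "a \<in> skew_forms"
  shows "trace (Finite_Cartesian_Product.transpose p ** congruence_rep X a) = - 2 * trace (a ** p ** X)"
proof -
  let ?T = Finite_Cartesian_Product.transpose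
  have p: "?T p = - p" and a: "?T a = - a" using assms by (auto simp: skew_forms_def)
  have neg: "(- A) ** B = - (A ** B)" "A ** (- B) = - (A ** B)" "trace (- A) = - trace A" for A B :: "complex^'m^'m"
    by (simp_all add: matrix_matrix_mult_def Finite_Cartesian_Product.vec_eq_iff sum_negf trace_def)
  have 1: "trace (p ** (X ** a)) = trace (a ** p ** X)"
    using trace_mul_sym[of "p ** X" a] by (simp add: matrix_mul_assoc)
  have "trace (p ** (a ** ?T X)) = trace (?T (p ** (a ** ?T X)))"
    by (simp add: trace_def Finite_Cartesian_Product.transpose_def)
  also have "\<dots> = trace (X ** (a ** p))"
    by (simp add: matrix_transpose_mul p a neg matrix_mul_assoc)
  also have "\<dots> = trace (a ** p ** X)"
    by (rule trace_mul_sym)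
  finally have 2: "trace (p ** (a ** ?T X)) = trace (a ** p ** X)" .
  show ?thesis
    by (simp add: congruence_rep_def p neg matrix_add_ldistrib trace_sub 1 2)
qed

text \<open>\<open>g\<close> numbers the basis along a path; the form is the signed adjacency matrix
  of the edges whose lower end has parity \<open>r\<close>.\<close>

definition path_form :: "('m \<Rightarrow> nat) \<Rightarrow> nat \<Rightarrow> complex^'m^'m" where
  "path_form g r = (\<chi> i j. (if g j = Suc (g i) \<and> g i mod 2 = r then 1 else 0)
     - (if g i = Suc (g j) \<and> g j mod 2 = r then 1 else 0))"

lemma path_form_skew: "path_form g r \<in> skew_forms"
  by (rule skew_formsI) (simp add: path_form_def)

text \<open>Natural numbers as indices allow shifts along the path, and the value zero outside means
  that a missing neighbour contributes nothing.\<close>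

definition zero_extension :: "('m \<Rightarrow> nat) \<Rightarrow> complex^'m^'m \<Rightarrow> nat \<Rightarrow> nat \<Rightarrow> complex" where
  "zero_extension g p x y = (if x \<in> range g \<and> y \<in> range g then p $ (inv_into UNIV g x) $ (inv_into UNIV g y) else 0)"

lemma zero_extension_nth: "inj g \<Longrightarrow> zero_extension g p (g i) (g j) = p $ i $ j"
  by (simp add: zero_extension_def)

text \<open>A row of a path form is supported on the neighbours in the path, so multiplication by it
  shifts rows of \<open>p\<close> by one step, with a sign.\<close>

lemma path_form_mult_nth:
  fixes p :: "complex^'m^'m"
  assumes g: "bij_betw g UNIV {..<N}"
  shows "(path_form g r ** p) $ i $ j =
    (if g i mod 2 = r then zero_extension g p (Suc (g i)) (g j) else 0)
    - (if 0 < g i \<and> (g i - 1) mod 2 = r then zero_extension g p (g i - 1) (g j) else 0)"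
proof -
  have inj: "inj g" and ran: "range g = {..<N}" using g by (auto simp: bij_betw_def)
  let ?P = "\<lambda>y. zero_extension g p y (g j)"
  define x where "x = g i"
  have "x < N" using ran x_def by auto
  \<comment> \<open>For \<open>x = 0\<close> the truncated \<open>x - 1\<close> is \<open>0\<close>
    and not a neighbour; the guard \<open>0 < x\<close> removes this term.\<close>
  let ?F = "\<lambda>y. (if y = Suc x then (if x mod 2 = r then ?P y else 0) else 0)
      - (if y = x - 1 then (if 0 < x \<and> (x - 1) mod 2 = r then ?P y else 0) else 0)"
  have "(path_form g r ** p) $ i $ j = (\<Sum>k\<in>UNIV. ?F (g k))"
  proof -
    have pk: "p $ k $ j = ?P (g k)" for k by (simp add: zero_extension_nth[OF inj])
    show ?thesis
      unfolding matrix_matrix_mult_def path_form_def vec_lambda_beta x_def pk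
      by (rule sum.cong) auto
  qed
  also have "\<dots> = (\<Sum>y<N. ?F y)"
    by (rule sum.reindex_bij_betw[OF g])
  also have "\<dots> = (if Suc x < N then (if x mod 2 = r then ?P (Suc x) else 0) else 0)
      - (if 0 < x \<and> (x - 1) mod 2 = r then ?P (x - 1) else 0)"
    unfolding sum_subtractf using \<open>x < N\<close> by (simp add: less_imp_diff_less)
  also have "(if Suc x < N then (if x mod 2 = r then ?P (Suc x) else 0) else 0) = (if x mod 2 = r then ?P (Suc x) else 0)"
    by (simp add: zero_extension_def ran)
  finally show ?thesis by (simp add: x_def)
qed

lemma path_forms_annihilator:
  fixes p q :: "complex^'m^'m"
  assumes g: "bij_betw g UNIV {..<2 * n + 1}"
    and p: "p \<in> skew_forms" and q: "q \<in> skew_forms"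
    and eq: "path_form g 0 ** p + path_form g 1 ** q = Finite_Cartesian_Product.mat c"
  shows "p = 0" "q = 0"
proof -
  have inj: "inj g" and ran: "range g = {..<2 * n + 1}" using g by (auto simp: bij_betw_def)
  let ?P = "zero_extension g p" and ?Q = "zero_extension g q"
  have skew: "zero_extension g f x y = - zero_extension g f y x" if "f \<in> skew_forms" for f x y
    using skew_formsD[OF that, of "inv_into UNIV g x" "inv_into UNIV g y"] by (simp add: zero_extension_def)
  have out: "zero_extension g f x y = 0" if "2 * n < x" for f x y
    using that by (simp add: zero_extension_def ran)
  have row: "(if x mod 2 = 0 then ?P (Suc x) y else 0) - (if 0 < x \<and> (x - 1) mod 2 = 0 then ?P (x - 1) y else 0)
      + ((if x mod 2 = 1 then ?Q (Suc x) y else 0) - (if 0 < x \<and> (x - 1) mod 2 = 1 then ?Q (x - 1) y else 0))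
      = (if y = x then c else 0)" if "x \<le> 2 * n" "y \<le> 2 * n" for x y
  proof -
    have "x \<in> range g" "y \<in> range g" using that by (auto simp: ran)
    then obtain i j where ij: "x = g i" "y = g j" by blast
    have "(path_form g 0 ** p + path_form g 1 ** q) $ i $ j = (if y = x then c else 0)"
      unfolding eq using inj by (auto simp: Finite_Cartesian_Product.mat_def ij inj_eq)
    then show ?thesis
      by (simp only: vector_add_component path_form_mult_nth[OF g] ij)
  qed
  have PQ: "?P x y = 0" "?Q x y = 0" for x y
  proof -
    \<comment> \<open>The end of the path, row \<open>0\<close>, has a single neighbour and gives
      \<open>first\<close>; each inner row meets one even and one odd edge and gives
      \<open>even\<close> or \<open>odd\<close>.\<close>
    have first: "?P 1 j = (if j = 0 then c else 0)" if "j \<le> 2 * n" for j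
      using row[of 0 j] that by simp
    have even: "?P (2 * x + 3) j - ?Q (2 * x + 1) j = (if j = 2 * x + 2 then c else 0)"
      if "x < n" "j \<le> 2 * n" for x j
      using row[of "2 * x + 2" j] that by (simp add: numeral_3_eq_3)
    have odd: "?Q (2 * x + 2) j - ?P (2 * x) j = (if j = 2 * x + 1 then c else 0)"
      if "x < n" "j \<le> 2 * n" for x j
      using row[of "2 * x + 1" j] that by simp
    show "?P x y = 0" "?Q x y = 0"
      using path_pencil_annihilator[of ?P ?Q n c, OF skew[OF p] skew[OF q] out out first even odd]
      by auto
  qed
  show "p = 0" "q = 0"
    using PQ by (simp_all add: Finite_Cartesian_Product.vec_eq_iff flip: zero_extension_nth[OF inj])
qed

text \<open>Conjugating one argument turns the real inner product into the real part of the bilinear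
  trace form, so orthogonal complements can serve as annihilators.\<close>

lemma inner_eq_Re_trace:
  fixes x y :: "complex^'m^'m"
  shows "x \<bullet> y = Re (trace (Finite_Cartesian_Product.transpose (\<chi> i j. cnj (x $ i $ j)) ** y))"
proof -
  have "x \<bullet> y = (\<Sum>i\<in>UNIV. \<Sum>j\<in>UNIV. Re (cnj (x $ i $ j) * y $ i $ j))"
    by (simp add: inner_vec_def inner_complex_def)
  also have "\<dots> = (\<Sum>j\<in>UNIV. \<Sum>i\<in>UNIV. Re (cnj (x $ i $ j) * y $ i $ j))"
    by (rule sum.swap)
  finally show ?thesis
    by (simp add: trace_def matrix_matrix_mult_def Finite_Cartesian_Product.transpose_def Re_sum)
qed

lemma linear_congruence_rep_left:
  "Vector_Spaces.linear cmat_scale cmat_scale (\<lambda>X. congruence_rep X Q)"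
proof -
  have "congruence_rep (X + Y) Q = congruence_rep X Q + congruence_rep Y Q"
    "congruence_rep (cmat_scale c X) Q = cmat_scale c (congruence_rep X Q)" for X Y c
    by (simp_all add: congruence_rep_def cmat_scale_def matrix_matrix_mult_def
        Finite_Cartesian_Product.transpose_def Finite_Cartesian_Product.vec_eq_iff
        sum.distrib sum_distrib_left algebra_simps)
  then show ?thesis
    using vector_space_cmat_scale by (simp add: Vector_Spaces.linear_iff)
qed

lemma linear_congruence_rep_right:
  "Vector_Spaces.linear cmat_scale cmat_scale (\<lambda>Q. congruence_rep X Q)"
proof -
  have "congruence_rep X (P + Q) = congruence_rep X P + congruence_rep X Q"
    "congruence_rep X (cmat_scale c Q) = cmat_scale c (congruence_rep X Q)" for P Q c
    by (simp_all add: congruence_rep_def cmat_scale_def matrix_matrix_mult_def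
        Finite_Cartesian_Product.transpose_def Finite_Cartesian_Product.vec_eq_iff
        sum.distrib sum_distrib_left algebra_simps)
  then show ?thesis
    using vector_space_cmat_scale by (simp add: Vector_Spaces.linear_iff)
qed

text \<open>Restriction of scalars: it turns complex subspaces and linear maps into real ones, to
  which orthogonality for the real inner product applies.\<close>

lemma cmat_scale_of_real: "cmat_scale (of_real r) X = r *\<^sub>R X"
  by (simp add: cmat_scale_def Finite_Cartesian_Product.vec_eq_iff scaleR_conv_of_real[where 'a = complex])

text \<open>Were the image of \<open>sl\<close> proper, some nonzero pair of skew-symmetric matrices
  would be orthogonal to it. For the conjugate pair, \<open>?M\<close> is trace-orthogonal to
  \<open>sl\<close>, hence scalar, and \<open>path_forms_annihilator\<close> makes the pair
  zero.\<close>

lemma path_forms_surjective: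
  fixes g :: "'m::finite \<Rightarrow> nat"
  assumes g: "bij_betw g UNIV {..<2 * n + 1}" and "P \<in> skew_forms" "Q \<in> skew_forms"
  shows "\<exists>X\<in>sl. congruence_rep X (path_form g 0) = P \<and> congruence_rep X (path_form g 1) = Q"
proof -
  let ?a = "path_form g 0" and ?b = "path_form g 1"
  let ?\<Phi> = "\<lambda>X. (congruence_rep X ?a, congruence_rep X ?b)"
  interpret a: Vector_Spaces.linear cmat_scale cmat_scale "\<lambda>X. congruence_rep X ?a"
    by (rule linear_congruence_rep_left)
  interpret b: Vector_Spaces.linear cmat_scale cmat_scale "\<lambda>X. congruence_rep X ?b"
    by (rule linear_congruence_rep_left)
  have lin: "linear ?\<Phi>"
    by (rule linearI) (simp_all add: a.add b.add a.scale b.scale del: One_nat_def flip: cmat_scale_of_real)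
  have sl_sub: "subspace (sl :: (complex^'m^'m) set)"
    using subspace_sl unfolding cmat.subspace_def subspace_def cmat_scale_of_real[symmetric] by blast
  have skew_sub: "subspace (skew_forms :: (complex^'m^'m) set)"
    using subspace_skew_forms unfolding cmat.subspace_def subspace_def cmat_scale_of_real[symmetric] by blast
  have S: "subspace (?\<Phi> ` sl)" by (rule linear_subspace_image[OF lin sl_sub])
  have T: "subspace (skew_forms \<times> skew_forms :: ((complex^'m^'m) \<times> (complex^'m^'m)) set)"
    by (rule subspace_Times[OF skew_sub skew_sub])
  have sub: "?\<Phi> ` sl \<subseteq> skew_forms \<times> skew_forms"
    by (auto intro: congruence_rep_skew_forms path_form_skew)
  have "?\<Phi> ` sl = skew_forms \<times> skew_forms"
  proof (rule ccontr)
    assume "?\<Phi> ` sl \<noteq> skew_forms \<times> skew_forms"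
    moreover have span: "span (?\<Phi> ` sl) = ?\<Phi> ` sl"
      "span (skew_forms \<times> skew_forms) = (skew_forms \<times> skew_forms :: ((complex^'m^'m) \<times> (complex^'m^'m)) set)"
      using S T by (simp_all only: span_eq_iff)
    ultimately have "span (?\<Phi> ` sl) \<subset> span (skew_forms \<times> skew_forms)"
      unfolding span using sub by blast
    then have "\<exists>z. z \<noteq> 0 \<and> z \<in> span (skew_forms \<times> skew_forms) \<and>
        (\<forall>y\<in>span (?\<Phi> ` sl). Linear_Algebra.orthogonal z y)"
      by (rule orthogonal_to_subspace_exists_gen) blast
    then obtain z where z: "z \<noteq> 0" "z \<in> span (skew_forms \<times> skew_forms)"
      and orth: "\<And>y. y \<in> span (?\<Phi> ` sl) \<Longrightarrow> Linear_Algebra.orthogonal z y"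
      by blast
    obtain p' q' where pq': "z = (p', q')" "p' \<in> skew_forms" "q' \<in> skew_forms"
      using z(2) unfolding span(2) by blast
    define p where "p = (\<chi> i j. cnj (p' $ i $ j))"
    define q where "q = (\<chi> i j. cnj (q' $ i $ j))"
    have p: "p \<in> skew_forms" and q: "q \<in> skew_forms"
      unfolding p_def q_def using skew_formsD[OF pq'(2)] skew_formsD[OF pq'(3)]
      by (metis (no_types, lifting) complex_cnj_minus skew_formsI vec_lambda_beta)+
    let ?M = "?a ** p + ?b ** q"
    have add_mult: "(A + B) ** C = A ** C + B ** C" for A B C :: "complex^'m^'m"
      by (simp add: matrix_matrix_mult_def Finite_Cartesian_Product.vec_eq_iff distrib_right sum.distrib)
    have Re: "Re (trace (?M ** X)) = 0" if "X \<in> sl" for X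
    proof -
      have "z \<bullet> ?\<Phi> X = 0"
        using orth[of "?\<Phi> X"] that by (simp add: Linear_Algebra.orthogonal_def span_base)
      moreover have "z \<bullet> ?\<Phi> X = - 2 * Re (trace (?M ** X))"
        unfolding pq'(1) inner_prod_def fst_conv snd_conv inner_eq_Re_trace p_def[symmetric] q_def[symmetric]
          trace_pairing_congruence_rep[OF p path_form_skew] trace_pairing_congruence_rep[OF q path_form_skew]
        by (simp add: add_mult trace_add)
      ultimately show ?thesis by simp
    qed
    \<comment> \<open>Real orthogonality controls only real parts; multiplying \<open>X\<close> by
      \<open>\<i>\<close>, which stays in \<open>sl\<close>, controls the imaginary parts.\<close>
    have "trace (?M ** X) = 0" if X: "X \<in> sl" for X
    proof -
      have "?M ** cmat_scale \<i> X = cmat_scale \<i> (?M ** X)"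
        by (simp add: matrix_matrix_mult_def cmat_scale_def Finite_Cartesian_Product.vec_eq_iff
            sum_distrib_left algebra_simps)
      then have "Im (trace (?M ** X)) = 0"
        using Re[of "cmat_scale \<i> X"] cmat.subspace_scale[OF subspace_sl X, of \<i>]
        by (simp add: trace_cmat_scale)
      then show ?thesis using Re[OF X] by (simp add: complex_eq_iff)
    qed
    then obtain c where "?M = Finite_Cartesian_Product.mat c"
      using scalar_of_trace_orthogonal_sl by blast
    then have "p = 0" "q = 0"
      using path_forms_annihilator[OF g p q] by blast+
    then have "z = 0"
      unfolding pq'(1) p_def q_def by (simp add: Finite_Cartesian_Product.vec_eq_iff zero_prod_def)
    then show False using z(1) by simp
  qed
  then have "(P, Q) \<in> ?\<Phi> ` sl" using assms by blast
  then show ?thesis by auto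
qed

subsection \<open>Zariski openness and the invariants\<close>

lemma polynomial_map_sum:
  assumes "finite I" "\<And>i. i \<in> I \<Longrightarrow> polynomial_map s (f i)"
  shows "polynomial_map s (\<lambda>x. \<Sum>i\<in>I. f i x)"
  using assms by (induction rule: finite_induct) (auto intro: polynomial_map.intros)

lemma polynomial_map_prod:
  assumes "finite I" "\<And>i. i \<in> I \<Longrightarrow> polynomial_map s (f i)"
  shows "polynomial_map s (\<lambda>x. \<Prod>i\<in>I. f i x)"
  using assms by (induction rule: finite_induct) (auto intro: polynomial_map.intros)

lemma polynomial_map_det:
  fixes M :: "'a :: ab_group_add \<Rightarrow> complex^'k^'k"
  assumes "\<And>i j. polynomial_map s (\<lambda>x. M x $ i $ j)"
  shows "polynomial_map s (\<lambda>x. Determinants.det (M x))"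
  unfolding Determinants.det_def
  by (intro polynomial_map_sum polynomial_map_prod polynomial_map.mult polynomial_map.const assms)
    (auto intro: finite_permutations)

interpretation cmat2: vector_space_prod
  "cmat_scale :: complex \<Rightarrow> complex^'m^'m \<Rightarrow> complex^'m^'m"
  "cmat_scale :: complex \<Rightarrow> complex^'m^'m \<Rightarrow> complex^'m^'m"
  by unfold_locales

lemma linear_cmat_nth: "Vector_Spaces.linear cmat_scale (*) (\<lambda>X. X $ i $ j)"
  using vector_space_cmat_scale
  by (simp add: Vector_Spaces.linear_iff cmat_scale_def vector_space_over_itself.vector_space_axioms)

lemma linear_prod_fst_snd:
  assumes "Vector_Spaces.linear cmat_scale (*) (f :: complex^'m^'m \<Rightarrow> complex)"
  shows "Vector_Spaces.linear (module_prod.scale cmat_scale cmat_scale) (*) (\<lambda>x :: (complex^'m^'m) \<times> (complex^'m^'m). f (fst x))"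
    and "Vector_Spaces.linear (module_prod.scale cmat_scale cmat_scale) (*) (\<lambda>x :: (complex^'m^'m) \<times> (complex^'m^'m). f (snd x))"
  using assms cmat2.p.vector_space_axioms
  by (simp_all add: Vector_Spaces.linear_iff cmat2.scale_def)

lemma polynomial_map_congruence_rep_nth:
  "polynomial_map (module_prod.scale cmat_scale cmat_scale) (\<lambda>x :: (complex^'m^'m) \<times> (complex^'m^'m). congruence_rep X (fst x) $ i $ j)"
  "polynomial_map (module_prod.scale cmat_scale cmat_scale) (\<lambda>x :: (complex^'m^'m) \<times> (complex^'m^'m). congruence_rep X (snd x) $ i $ j)"
proof -
  have "Vector_Spaces.linear cmat_scale (*) (\<lambda>Q. congruence_rep X Q $ i $ j)"
    using linear_congruence_rep_right[of X] linear_cmat_nth[of i j]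
    by (simp add: Vector_Spaces.linear_iff)
  then show "polynomial_map (module_prod.scale cmat_scale cmat_scale) (\<lambda>x :: (complex^'m^'m) \<times> (complex^'m^'m). congruence_rep X (fst x) $ i $ j)"
    "polynomial_map (module_prod.scale cmat_scale cmat_scale) (\<lambda>x :: (complex^'m^'m) \<times> (complex^'m^'m). congruence_rep X (snd x) $ i $ j)"
    by (auto intro: polynomial_map.linear linear_prod_fst_snd)
qed

definition symm_part :: "complex^'m^'m \<Rightarrow> complex^'m^'m" where
  "symm_part A = (\<chi> i j. (A $ i $ j + A $ j $ i) / 2)"

definition skew_part :: "complex^'m^'m \<Rightarrow> complex^'m^'m" where
  "skew_part A = (\<chi> i j. (A $ i $ j - A $ j $ i) / 2)"

lemma skew_part_mem: "skew_part A \<in> skew_forms"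
  by (rule skew_formsI) (simp add: skew_part_def field_simps)

lemma skew_part_plus_symm_part: "skew_part A + symm_part A = A"
  by (simp add: skew_part_def symm_part_def Finite_Cartesian_Product.vec_eq_iff field_simps)

text \<open>The difference \<open>P - Y\<close> is skew-symmetric and equals the symmetric
  \<open>S\<close>, so it vanishes.\<close>

lemma skew_part_eq:
  assumes Y: "Y \<in> skew_forms" and P: "P \<in> skew_forms" and S: "\<And>i j. S $ i $ j = S $ j $ i"
    and eq: "Y + S = P"
  shows "Y = P"
proof -
  have "Y $ i $ j = P $ i $ j" for i j
  proof -
    have "Y $ i $ j + S $ i $ j = P $ i $ j" "Y $ j $ i + S $ j $ i = P $ j $ i"
      using eq by (metis vector_add_component)+
    then have "S $ i $ j = P $ i $ j - Y $ i $ j" "S $ i $ j = Y $ i $ j - P $ i $ j"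
      using skew_formsD[OF Y, of j i] skew_formsD[OF P, of j i] S[of j i]
      by (simp_all add: algebra_simps)
    then have "2 * S $ i $ j = 0" by simp
    then show ?thesis using \<open>Y $ i $ j + S $ i $ j = P $ i $ j\<close> by simp
  qed
  then show ?thesis unfolding Finite_Cartesian_Product.vec_eq_iff by blast
qed

text \<open>
  Surjectivity onto pairs of skew-symmetric forms is an open condition: complete the images of
  fixed preimages by symmetric matrices to a square system, whose determinant is a polynomial.
\<close>

lemma zariski_open_surjective:
  fixes a0 b0 :: "complex^'m^'m"
  assumes a0: "a0 \<in> skew_forms" and b0: "b0 \<in> skew_forms"
    and surj: "\<And>P Q. P \<in> skew_forms \<Longrightarrow> Q \<in> skew_forms \<Longrightarrow>
      \<exists>X\<in>sl. congruence_rep X a0 = P \<and> congruence_rep X b0 = Q"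
  obtains Z where "zariski_open_in (module_prod.scale cmat_scale cmat_scale) (skew_forms \<times> skew_forms) Z"
    and "(a0, b0) \<in> Z"
    and "\<And>a b P Q. (a, b) \<in> Z \<Longrightarrow> P \<in> skew_forms \<Longrightarrow> Q \<in> skew_forms \<Longrightarrow>
      \<exists>X\<in>sl. congruence_rep X a = P \<and> congruence_rep X b = Q"
proof -
  \<comment> \<open>The pairs \<open>(u1 t, u2 t)\<close> form the standard basis of all pairs of
    matrices: the flag in \<open>t\<close> selects the component, the rest the position.\<close>
  define u1 :: "bool \<times> 'm \<times> 'm \<Rightarrow> complex^'m^'m" where "u1 t = (if fst t then unit_mat (snd t) else 0)" for t
  define u2 :: "bool \<times> 'm \<times> 'm \<Rightarrow> complex^'m^'m" where "u2 t = (if fst t then 0 else unit_mat (snd t))" for t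
  have "\<exists>X. \<forall>t. X t \<in> sl \<and> congruence_rep (X t) a0 = skew_part (u1 t) \<and>
      congruence_rep (X t) b0 = skew_part (u2 t)"
    using surj[OF skew_part_mem skew_part_mem] by (intro choice allI) blast
  then obtain X where X: "\<And>t. X t \<in> sl" "\<And>t. congruence_rep (X t) a0 = skew_part (u1 t)"
      "\<And>t. congruence_rep (X t) b0 = skew_part (u2 t)"
    by blast
  \<comment> \<open>Only the first summands vary with \<open>x\<close>; the symmetric parts are
    fixed so that \<open>E (a0, b0) t\<close> is the basis pair \<open>(u1 t, u2 t)\<close>.\<close>
  define E where "E x t = (congruence_rep (X t) (fst x) + symm_part (u1 t),
    congruence_rep (X t) (snd x) + symm_part (u2 t))" for x t
  \<comment> \<open>Column \<open>t\<close> lists the coordinates of \<open>E x t\<close>, so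
    \<open>M\<close> is the identity at \<open>(a0, b0)\<close>.\<close>
  define M :: "(complex^'m^'m) \<times> (complex^'m^'m) \<Rightarrow> complex^(bool \<times> 'm \<times> 'm)^(bool \<times> 'm \<times> 'm)"
    where "M x = (\<chi> s t. (if fst s then fst (E x t) else snd (E x t)) $ fst (snd s) $ snd (snd s))" for x
  have poly: "polynomial_map (module_prod.scale cmat_scale cmat_scale) (\<lambda>x. M x $ s $ t)" for s t
    unfolding M_def E_def
    by (cases "fst s") (auto intro!: polynomial_map.add polynomial_map.const polynomial_map_congruence_rep_nth)
  define Z where "Z = {x \<in> skew_forms \<times> skew_forms. Determinants.det (M x) \<noteq> 0}"
  have "zariski_open_in (module_prod.scale cmat_scale cmat_scale) (skew_forms \<times> skew_forms) Z"
    unfolding zariski_open_in_def Z_def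
    by (rule exI[of _ "{\<lambda>x. Determinants.det (M x)}"]) (auto intro: polynomial_map_det poly)
  moreover have "(a0, b0) \<in> Z"
  proof -
    have "E (a0, b0) t = (u1 t, u2 t)" for t
      unfolding E_def by (simp add: X skew_part_plus_symm_part)
    then have "M (a0, b0) = Finite_Cartesian_Product.mat 1"
      unfolding M_def Finite_Cartesian_Product.mat_def
      by (auto simp: Finite_Cartesian_Product.vec_eq_iff u1_def u2_def unit_mat_def)
    then show ?thesis using a0 b0 by (simp add: Z_def Determinants.det_I)
  qed
  moreover have "\<exists>Y\<in>sl. congruence_rep Y a = P \<and> congruence_rep Y b = Q"
    if "(a, b) \<in> Z" and P: "P \<in> skew_forms" and Q: "Q \<in> skew_forms" for a b P Q
  proof -
    have a: "a \<in> skew_forms" and b: "b \<in> skew_forms" and "Determinants.det (M (a, b)) \<noteq> 0"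
      using that(1) by (auto simp: Z_def)
    then have "invertible (M (a, b))" by (simp add: invertible_det_nz)
    then have "surj ((*v) (M (a, b)))" by (rule invertible_eq_bij[THEN iffD1, THEN bij_is_surj])
    from surjD[OF this, of "\<chi> s. (if fst s then P else Q) $ fst (snd s) $ snd (snd s)"]
    obtain v where v: "(\<chi> s. (if fst s then P else Q) $ fst (snd s) $ snd (snd s)) = M (a, b) *v v"
      by (elim exE)
    have v_nth: "(\<Sum>t\<in>UNIV. v $ t * (if r then fst (E (a, b) t) else snd (E (a, b) t)) $ i $ j)
        = (if r then P else Q) $ i $ j" for r i j
      using arg_cong[OF v, of "\<lambda>w. w $ (r, i, j)"]
      by (simp add: matrix_vector_mult_def M_def mult.commute)
    \<comment> \<open>\<open>Y\<close> combines the \<open>X t\<close> with the coefficients that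
      express \<open>(P, Q)\<close> in the columns of \<open>M\<close>. \<open>S1\<close> and
      \<open>S2\<close> collect the symmetric completions, which vanish as differences of
      skew-symmetric matrices.\<close>
    define Y where "Y = (\<Sum>t\<in>UNIV. cmat_scale (v $ t) (X t))"
    define S1 where "S1 = (\<Sum>t\<in>UNIV. cmat_scale (v $ t) (symm_part (u1 t)))"
    define S2 where "S2 = (\<Sum>t\<in>UNIV. cmat_scale (v $ t) (symm_part (u2 t)))"
    have rep: "congruence_rep Y c = (\<Sum>t\<in>UNIV. cmat_scale (v $ t) (congruence_rep (X t) c))" for c
    proof -
      interpret Vector_Spaces.linear cmat_scale cmat_scale "\<lambda>X. congruence_rep X c"
        by (rule linear_congruence_rep_left)
      show ?thesis unfolding Y_def by (simp add: sum scale)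
    qed
    have "Y \<in> sl"
      unfolding Y_def by (intro cmat.subspace_sum cmat.subspace_scale subspace_sl X)
    moreover have "congruence_rep Y a = P"
    proof (rule skew_part_eq[OF congruence_rep_skew_forms[OF a] P])
      show "S1 $ i $ j = S1 $ j $ i" for i j
        by (simp add: S1_def symm_part_def cmat_scale_def add.commute)
      show "congruence_rep Y a + S1 = P"
        using v_nth[of True]
        by (simp add: rep S1_def E_def cmat_scale_def Finite_Cartesian_Product.vec_eq_iff
            distrib_left sum.distrib)
    qed
    moreover have "congruence_rep Y b = Q"
    proof (rule skew_part_eq[OF congruence_rep_skew_forms[OF b] Q])
      show "S2 $ i $ j = S2 $ j $ i" for i j
        by (simp add: S2_def symm_part_def cmat_scale_def add.commute)
      show "congruence_rep Y b + S2 = Q"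
        using v_nth[of False]
        by (simp add: rep S2_def E_def cmat_scale_def Finite_Cartesian_Product.vec_eq_iff
            distrib_left sum.distrib)
    qed
    ultimately show ?thesis by blast
  qed
  ultimately show ?thesis by (rule that)
qed

interpretation cmat_pair: complex_vector_space_pair
  "cmat_scale :: complex \<Rightarrow> complex^'m^'m \<Rightarrow> complex^'m^'m" "range unit_mat"
  "cmat_scale :: complex \<Rightarrow> complex^'m^'m \<Rightarrow> complex^'m^'m" "range unit_mat"
  by unfold_locales

theorem theorem4p23:
  fixes n \<delta> :: nat and \<gg> :: "(complex^'m^'m) set" and H :: "nat multiset"
  assumes "n \<ge> 1" and "CARD('m) = 2 * n + 1"
    and "(\<gg> = gl \<and> \<delta> = 1) \<or> (\<gg> = sl \<and> \<delta> = 0)"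
    and "H = replicate_mset (2 * n + \<delta>) 1 + replicate_mset (n * (2 * n + 1)) 2"
  shows "size H = n * (2 * n + 3) + \<delta> \<and>
    has_jk_invariants cmat_scale \<gg> cmat_scale skew_forms congruence_rep
      \<lparr> jordan_part = {#}, horizontal_indices = H, vertical_indices = {#} \<rparr>"
proof
  show "size H = n * (2 * n + 3) + \<delta>"
    using assms(4) by (simp add: algebra_simps)
  have dim_skew: "cmat.dim (skew_forms :: (complex^'m^'m) set) = n * (2 * n + 1)"
    using dim_skew_forms[where 'm = 'm] unfolding assms(2) by (simp add: power2_eq_square algebra_simps)
  \<comment> \<open>Written so that removing two dimensions for each dimension of the skew-symmetric
    forms leaves the \<open>2 * n + \<delta>\<close> blocks of width 1.\<close>
  have dim_\<gg>: "cmat.dim \<gg> = 2 * n + \<delta> + 2 * (n * (2 * n + 1))"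
    using assms(3) dim_gl[where 'm = 'm] dim_sl[where 'm = 'm] unfolding assms(2)
    by (auto simp: power2_eq_square algebra_simps)
  \<comment> \<open>Surjectivity on \<open>sl\<close> passes to any larger subspace, so one open set
    serves both cases.\<close>
  have \<gg>: "cmat.subspace \<gg>" "sl \<subseteq> \<gg>"
    using assms(3) subspace_sl by (auto simp: gl_def)
  obtain g :: "'m \<Rightarrow> nat" where "bij_betw g UNIV {..<2 * n + 1}"
    using ex_bij_betw_finite_nat[of "UNIV :: 'm set"] assms(2) by (auto simp: atLeast0LessThan)
  note surj = path_forms_surjective[OF this]
  obtain Z where Z: "zariski_open_in (module_prod.scale cmat_scale cmat_scale) (skew_forms \<times> skew_forms) Z"
    "(path_form g 0, path_form g 1) \<in> Z"
    "\<And>a b P Q. (a, b) \<in> Z \<Longrightarrow> P \<in> skew_forms \<Longrightarrow> Q \<in> skew_forms \<Longrightarrow>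
      \<exists>X\<in>sl. congruence_rep X a = P \<and> congruence_rep X b = Q"
    using zariski_open_surjective[OF path_form_skew path_form_skew surj] by blast
  have "has_algebraic_type cmat_scale \<gg> cmat_scale skew_forms
      (\<lambda>\<xi>. congruence_rep \<xi> a) (\<lambda>\<xi>. congruence_rep \<xi> b)
      \<lparr> jordan_part = {#}, horizontal_indices = H, vertical_indices = {#} \<rparr>"
    if ab: "(a, b) \<in> Z" for a b
  proof -
    have skew: "a \<in> skew_forms" "b \<in> skew_forms"
      using ab Z(1) by (auto simp: zariski_open_in_def)
    have "\<exists>X\<in>\<gg>. congruence_rep X a = P \<and> congruence_rep X b = Q"
      if "P \<in> skew_forms" "Q \<in> skew_forms" for P Q
      using Z(3)[OF ab that] \<gg>(2) by blast
    from cmat_pair.has_algebraic_type_of_surjective[OF linear_congruence_rep_left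
        linear_congruence_rep_left \<gg>(1) subspace_skew_forms congruence_rep_skew_forms[OF skew(1)]
        congruence_rep_skew_forms[OF skew(2)] this]
    show ?thesis by (simp add: dim_skew dim_\<gg> assms(4))
  qed
  then show "has_jk_invariants cmat_scale \<gg> cmat_scale skew_forms congruence_rep
      \<lparr> jordan_part = {#}, horizontal_indices = H, vertical_indices = {#} \<rparr>"
    unfolding has_jk_invariants_def using Z(1,2) by (intro exI[of _ Z]) auto
qed

end
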